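(* Let $k_1\geqslant 2$, $\ell\geqslant 2$ and $k_2\geqslant 0$ be integers, and let $n\geqslant (2\ell^2+3\ell-4)k_1+(4\ell^2-2\ell+1)k_2+3$. Let $G_2(n,k_1,k_2,2\ell)=K_{\ell k_1+k_2-1}\vee\overline{K}_{n-\ell k_1-k_2+1}$. Then $$ex(n, k_1P_{2\ell}\cup k_2S_{2\ell-1})=e(G_2(n,k_1,k_2,2\ell))=(\ell k_1+k_2-1)n-\frac{(\ell k_1+k_2)(\ell k_1+k_2-1)}{2},$$ and $G_2(n,k_1,k_2,2\ell)$ is, up to isomorphism, the unique $n$-vertex $(k_1P_{2\ell}\cup k_2S_{2\ell-1})$-free graph with this number of edges.
   Context: All graphs are finite, simple and undirected. $K_m$ is the complete graph on $m$ vertices, $\overline{K}_m$ the edgeless graph on $m$ vertices, $P_m$ the path on $m$ vertices, and $S_{m}$ the star on $m+1$ vertices. $G\cup H$ is the disjoint union, $tG$ the disjoint union of $t$ copies of $G$, and $G\vee H$ the join (disjoint union plus all edges between $V(G)$ and $V(H)$). $e(G)$ is the number of edges. For a graph $F$, $ex(n,F)$ is the maximum number of edges of an $n$-vertex graph containing no subgraph isomorphic to $F$. *)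

theory Defs
  imports Complex_Main
begin

datatype 'a graph = Graph (verts: "'a set") (edges: "'a set set")

definition simple_graph :: "'a graph \<Rightarrow> bool" where
  "simple_graph G \<longleftrightarrow> finite (verts G) \<and> (\<forall>e\<in>edges G. e \<subseteq> verts G \<and> card e = 2)"

definition num_edges :: "'a graph \<Rightarrow> nat" where
  "num_edges G = card (edges G)"

definition subgraph :: "'a graph \<Rightarrow> 'a graph \<Rightarrow> bool" where
  "subgraph H G \<longleftrightarrow> simple_graph H \<and> verts H \<subseteq> verts G \<and> edges H \<subseteq> edges G"

definition isomorphic :: "'a graph \<Rightarrow> 'b graph \<Rightarrow> bool" where
  "isomorphic G H \<longleftrightarrow>
     (\<exists>f. bij_betw f (verts G) (verts H) \<and> edges H = (\<lambda>e. f ` e) ` edges G)"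

definition graph_free :: "'b graph \<Rightarrow> 'a graph \<Rightarrow> bool" where
  "graph_free F G \<longleftrightarrow> \<not> (\<exists>H. subgraph H G \<and> isomorphic H F)"

(* Every finite graph has an isomorphic copy on natural-number vertices, so ranging over
   nat graphs loses nothing. The set of edge counts is bounded by n choose 2; it is
   nonempty (so that Max is meaningful) whenever F has an edge. *)
definition ex :: "nat \<Rightarrow> 'b graph \<Rightarrow> nat" where
  "ex n F = Max {num_edges G | G :: nat graph.
     simple_graph G \<and> card (verts G) = n \<and> graph_free F G}"

definition complete_graph :: "nat \<Rightarrow> nat graph" where
  "complete_graph m = Graph {..<m} {e. e \<subseteq> {..<m} \<and> card e = 2}"

definition edgeless_graph :: "nat \<Rightarrow> nat graph" where
  "edgeless_graph m = Graph {..<m} {}"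

(* The index of a path counts its vertices. *)
definition path_graph :: "nat \<Rightarrow> nat graph" where
  "path_graph m = Graph {..<m} {{i, Suc i} | i. Suc i < m}"

(* The index of a star counts its leaves: m + 1 vertices, with centre 0. *)
definition star_graph :: "nat \<Rightarrow> nat graph" where
  "star_graph m = Graph {..m} {{0, i} | i. 1 \<le> i \<and> i \<le> m}"

definition disjoint_union :: "'a graph \<Rightarrow> 'b graph \<Rightarrow> ('a + 'b) graph" where
  "disjoint_union G H = Graph (verts G <+> verts H)
     ((\<lambda>e. Inl ` e) ` edges G \<union> (\<lambda>e. Inr ` e) ` edges H)"

definition copies :: "nat \<Rightarrow> 'a graph \<Rightarrow> (nat \<times> 'a) graph" where
  "copies t G = Graph ({..<t} \<times> verts G) {Pair i ` e | i e. i < t \<and> e \<in> edges G}"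

definition graph_join :: "'a graph \<Rightarrow> 'b graph \<Rightarrow> ('a + 'b) graph" where
  "graph_join G H = Graph (verts G <+> verts H)
     (edges (disjoint_union G H) \<union> {{Inl u, Inr v} | u v. u \<in> verts G \<and> v \<in> verts H})"

definition path_star_forest ::
  "nat \<Rightarrow> nat \<Rightarrow> nat \<Rightarrow> ((nat \<times> nat) + (nat \<times> nat)) graph" where
  "path_star_forest k1 k2 l =
     disjoint_union (copies k1 (path_graph (2 * l))) (copies k2 (star_graph (2 * l - 1)))"

(* The last argument is l, i.e. half the number of vertices of each path and star. *)
definition G2 :: "nat \<Rightarrow> nat \<Rightarrow> nat \<Rightarrow> nat \<Rightarrow> (nat + nat) graph" where
  "G2 n k1 k2 l =
     graph_join (complete_graph (l * k1 + k2 - 1)) (edgeless_graph (n - l * k1 - k2 + 1))"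

end

theory Submission
  imports Defs
begin

text \<open>Put \<open>s = lk\<^sub>1 + k\<^sub>2 - 1\<close>. The forest has a matching of size \<open>s + 1\<close>, so a graph whose edges all meet a
  set of \<open>s\<close> vertices does not contain it.

  Without stars, let \<open>G\<close> be free of \<open>k\<^sub>1\<close> disjoint paths, hence of paths on \<open>2s + 2\<close> vertices, with at least
  the extremal number of edges. It has a dense core in which deleting any set of vertices destroys many
  edges; every component of the core contains a path on at least \<open>lk\<^sub>1\<close> vertices, cut into
  \<open>\<lceil>k\<^sub>1 / 2\<rceil>\<close> pieces, so the core is connected. If the core has no subgraph of minimum
  degree \<open>s + 1\<close>, then degeneracy bounds its edges by the extremal number, and equality forces minimum
  degree \<open>s\<close>; rotating longest paths then produces a cycle of length \<open>2s\<close>, every second vertex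
  of which is adjacent to everything. Otherwise let \<open>t > s\<close> be the largest minimum degree of a
  subgraph. Extending that subgraph to the core of minimum degree \<open>2s + 1 - t\<close>, a path argument shows
  that this core is connected and has at most \<open>2s + 1\<close> vertices, which leaves too few edges.

  The stars are added by induction on \<open>k\<^sub>2\<close>, deleting a vertex of large degree.\<close>

section \<open>Induced subgraphs and edge counts\<close>

text \<open>A core defined by minimum degree alone could have small components, and a small
  component carries no long path. The condition on sets of vertices passes to components and forces
  each of them to have at least \<open>2 * c + 2\<close> vertices. With \<open>q\<close> half of
  \<open>k1\<close> rounded up and \<open>c + 1 = l * q\<close>, two components would give
  \<open>2 * q\<close> pieces. Since \<open>k1\<close> is at least 2, \<open>q < k1\<close> and
  \<open>c < s\<close>: each vertex outside the core contributes fewer edges than the slope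
  \<open>s\<close> of the extremal number, and a lower bound on \<open>n\<close> linear in
  \<open>l * k1\<close> exploits this gap. The degrees \<open>t\<close> and
  \<open>2s + 1 - t\<close> are complementary, as in Kopylov's argument for paths: their sum is just
  enough for a path on \<open>2s + 2\<close> vertices, while maximality of \<open>t\<close> makes
  the inner core \<open>t\<close>-degenerate and so bounds its edges. For the stars the obstacle is
  a vertex of a packed star with many neighbours outside the packing. Each star has at most one, of
  degree below \<open>2 * l * (k1 + k2) - 1\<close>; such degrees, also allowed to every path
  vertex, are what the bound on \<open>n\<close> has to absorb.\<close>

locale edge_set =
  fixes E :: "'a set set"
  assumes card_edge: "e \<in> E \<Longrightarrow> card e = 2"
begin

definition adj :: "'a \<Rightarrow> 'a \<Rightarrow> bool" where
  "adj x y \<longleftrightarrow> {x, y} \<in> E"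

text \<open>\<open>v\<close> need not lie in \<open>W\<close>: the cardinality is a degree when
  \<open>v\<close> is in \<open>W\<close> and counts the edges from \<open>v\<close> into
  \<open>W\<close> otherwise.\<close>

definition nbrs :: "'a set \<Rightarrow> 'a \<Rightarrow> 'a set" where
  "nbrs W v = {u \<in> W. adj v u}"

definition induced :: "'a set \<Rightarrow> 'a set set" where
  "induced W = {e \<in> E. e \<subseteq> W}"

definition ecount :: "'a set \<Rightarrow> nat" where
  "ecount W = card (induced W)"

lemma adj_sym: "adj x y \<Longrightarrow> adj y x"
  by (simp add: adj_def insert_commute)

lemma adj_irrefl [simp]: "\<not> adj x x"
  using card_edge by (fastforce simp: adj_def)

lemma nbrs_subset: "nbrs W v \<subseteq> W"
  by (auto simp: nbrs_def)

lemma finite_nbrs [simp]: "finite W \<Longrightarrow> finite (nbrs W v)"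
  by (simp add: nbrs_def)

lemma nbrs_mono: "X \<subseteq> W \<Longrightarrow> nbrs X v \<subseteq> nbrs W v"
  by (auto simp: nbrs_def)

lemma card_nbrs_mono: "X \<subseteq> W \<Longrightarrow> finite W \<Longrightarrow> card (nbrs X v) \<le> card (nbrs W v)"
  by (simp add: card_mono nbrs_mono)

lemma not_in_nbrs [simp]: "v \<notin> nbrs W v"
  by (simp add: nbrs_def)

lemma finite_induced [simp]: "finite W \<Longrightarrow> finite (induced W)"
  by (rule finite_subset[of _ "Pow W"]) (auto simp: induced_def)

lemma ecount_empty [simp]: "ecount {} = 0"
  using card_edge by (force simp: ecount_def induced_def)

lemma induced_insert:
  assumes "v \<notin> W"
  shows "induced (insert v W) = induced W \<union> (\<lambda>u. {v, u}) ` nbrs W v"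
proof
  show "induced (insert v W) \<subseteq> induced W \<union> (\<lambda>u. {v, u}) ` nbrs W v"
  proof
    fix e assume e: "e \<in> induced (insert v W)"
    show "e \<in> induced W \<union> (\<lambda>u. {v, u}) ` nbrs W v"
    proof (cases "v \<in> e")
      case True
      obtain a b where ab: "e = {a, b}" "a \<noteq> b"
        using card_edge[of e] e by (auto simp: induced_def card_2_iff)
      obtain u where u: "e = {v, u}" "u \<noteq> v"
        using True ab by auto
      with e have "u \<in> nbrs W v"
        by (auto simp: induced_def nbrs_def adj_def)
      with u show ?thesis by auto
    next
      case False
      with e show ?thesis by (auto simp: induced_def)
    qed
  qed
qed (auto simp: induced_def nbrs_def adj_def)

lemma ecount_insert:
  assumes "finite W" "v \<notin> W"
  shows "ecount (insert v W) = ecount W + card (nbrs W v)"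
proof -
  have "inj_on (\<lambda>u. {v, u}) (nbrs W v)"
    by (auto simp: inj_on_def doubleton_eq_iff)
  moreover have "induced W \<inter> (\<lambda>u. {v, u}) ` nbrs W v = {}"
    using assms by (auto simp: induced_def)
  ultimately show ?thesis
    using assms by (simp add: ecount_def induced_insert card_Un_disjoint card_image)
qed

lemma nbrs_Diff_self: "nbrs (W - {v}) v = nbrs W v"
  using adj_irrefl by (auto simp: nbrs_def)

lemma ecount_remove:
  assumes "finite W" "v \<in> W"
  shows "ecount W = ecount (W - {v}) + card (nbrs W v)"
  using ecount_insert[of "W - {v}" v] assms by (simp add: insert_absorb nbrs_Diff_self)

lemma ecount_le_pairs:
  assumes "finite W"
  shows "2 * ecount W \<le> card W * (card W - 1)"
  using assms
proof (induction W)
  case (insert v W)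
  have "card (nbrs W v) \<le> card W"
    using insert by (simp add: card_mono nbrs_subset)
  moreover have "card W * (card W - 1) + 2 * card W = (card W + 1) * card W"
    by (cases "card W") auto
  ultimately show ?case
    using insert by (simp add: ecount_insert)
qed simp

lemma handshake:
  assumes "finite W"
  shows "2 * ecount W = (\<Sum>v\<in>W. card (nbrs W v))"
  using assms
proof (induction W)
  case (insert v W)
  have "card (nbrs (insert v W) u) = card (nbrs W u) + (if adj u v then 1 else 0)" if "u \<in> W" for u
  proof -
    have "nbrs (insert v W) u = (if adj u v then insert v (nbrs W u) else nbrs W u)"
      by (auto simp: nbrs_def)
    moreover have "v \<notin> nbrs W u"
      using insert by (auto simp: nbrs_def)
    ultimately show ?thesis
      using insert by simp
  qed
  then have "(\<Sum>u\<in>W. card (nbrs (insert v W) u))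
      = (\<Sum>u\<in>W. card (nbrs W u)) + (\<Sum>u\<in>W. if adj u v then 1 else 0)"
    by (simp add: sum.distrib)
  also have "(\<Sum>u\<in>W. if adj u v then 1 else 0) = card {u \<in> W. adj u v}"
    using insert by (simp add: sum.If_cases Int_def)
  also have "{u \<in> W. adj u v} = nbrs W v"
    by (auto simp: nbrs_def dest: adj_sym)
  moreover have "nbrs (insert v W) v = nbrs W v"
    by (auto simp: nbrs_def)
  ultimately show ?case
    using insert by (simp add: ecount_insert)
qed simp

lemma ecount_Un_le:
  assumes "finite B" "finite W" "B \<inter> W = {}"
  shows "ecount (B \<union> W) \<le> ecount B + ecount W + (\<Sum>v\<in>B. card (nbrs W v))"
  using assms
proof (induction B)
  case (insert v B)
  have "nbrs (B \<union> W) v \<subseteq> nbrs B v \<union> nbrs W v"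
    by (auto simp: nbrs_def)
  then have "card (nbrs (B \<union> W) v) \<le> card (nbrs B v \<union> nbrs W v)"
    using insert by (intro card_mono) auto
  also have "\<dots> \<le> card (nbrs B v) + card (nbrs W v)"
    by (rule card_Un_le)
  finally show ?case
    using insert by (simp add: ecount_insert)
qed simp

lemma ecount_Un_le_degrees:
  assumes "finite A" "finite W" "A \<inter> W = {}" "A \<union> W \<subseteq> V" "finite V"
  shows "ecount (A \<union> W) \<le> ecount W + (\<Sum>v\<in>A. card (nbrs V v))"
  using assms
proof (induction A)
  case (insert v A)
  have "card (nbrs (A \<union> W) v) \<le> card (nbrs V v)"
    using insert.prems by (intro card_nbrs_mono) auto
  with insert show ?case
    by (simp add: ecount_insert)
qed simp

lemma ecount_Un_no_cross:
  assumes "finite X" "finite Y" "X \<inter> Y = {}" "\<And>x y. x \<in> X \<Longrightarrow> y \<in> Y \<Longrightarrow> \<not> adj x y"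
  shows "ecount (X \<union> Y) = ecount X + ecount Y"
proof (rule antisym)
  have "nbrs Y x = {}" if "x \<in> X" for x
    using assms(4) that by (auto simp: nbrs_def)
  then show "ecount (X \<union> Y) \<le> ecount X + ecount Y"
    using ecount_Un_le[OF assms(1-3)] by simp
  have "e \<notin> induced Y" if "e \<in> induced X" for e
  proof
    assume "e \<in> induced Y"
    with that assms(3) have "e = {}" "e \<in> E" by (auto simp: induced_def)
    then show False using card_edge by fastforce
  qed
  then have "induced X \<inter> induced Y = {}" by blast
  then have "ecount X + ecount Y = card (induced X \<union> induced Y)"
    using assms by (simp add: ecount_def card_Un_disjoint)
  also have "\<dots> \<le> ecount (X \<union> Y)"
    using assms by (auto simp: ecount_def induced_def intro!: card_mono)
  finally show "ecount X + ecount Y \<le> ecount (X \<union> Y)" .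
qed

subsection \<open>Cores\<close>

definition min_deg :: "nat \<Rightarrow> 'a set \<Rightarrow> bool" where
  "min_deg d W \<longleftrightarrow> (\<forall>v\<in>W. d \<le> card (nbrs W v))"

text \<open>Vertices with at most \<open>d\<close> neighbours are removed one at a time until
  \<open>d\<close> vertices are left, which span at most a complete graph. For \<open>d = s\<close>
  the bound is the extremal number, written without subtraction or division.\<close>

lemma ecount_degenerate:
  assumes "finite W" "d \<le> card W"
    and "\<And>X. X \<subseteq> W \<Longrightarrow> X \<noteq> {} \<Longrightarrow> \<not> min_deg (Suc d) X"
  shows "2 * ecount W + d * (d + 1) \<le> 2 * d * card W"
  using assms
proof (induction "card W" arbitrary: W rule: less_induct)
  case less
  show ?case
  proof (cases "card W = d")
    case True
    have "d * (d - 1) + d * (d + 1) = 2 * d * d"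
      by (cases d) auto
    with ecount_le_pairs[of W] less.prems True show ?thesis by auto
  next
    case False
    then have ne: "W \<noteq> {}" using less.prems by auto
    then obtain v where v: "v \<in> W" "card (nbrs W v) \<le> d"
      using less.prems(3)[of W] by (auto simp: min_deg_def not_less_eq_eq)
    obtain m where m: "card W = Suc m" "card (W - {v}) = m"
      using v less.prems by (metis card.remove)
    have "2 * ecount (W - {v}) + d * (d + 1) \<le> 2 * d * card (W - {v})"
    proof (rule less.hyps)
      show "card (W - {v}) < card W" using m by simp
      show "finite (W - {v})" using less.prems by simp
      show "d \<le> card (W - {v})" using m False less.prems(2) by simp
      show "\<not> min_deg (Suc d) X" if "X \<subseteq> W - {v}" "X \<noteq> {}" for X
        using less.prems(3)[of X] that by blast
    qed
    moreover have "ecount W = ecount (W - {v}) + card (nbrs W v)"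
      using ecount_remove v less.prems by blast
    ultimately show ?thesis
      using v(2) unfolding m by (simp add: algebra_simps)
  qed
qed

text \<open>Removing vertices with at most \<open>d\<close> remaining neighbours never touches
  \<open>T\<close>, whose vertices have more than that inside \<open>T\<close>. The inequality
  charges \<open>d\<close> edges to each removed vertex.\<close>

lemma ex_core:
  assumes "finite W" "T \<subseteq> W" "min_deg (Suc d) T"
  shows "\<exists>U. T \<subseteq> U \<and> U \<subseteq> W \<and> min_deg (Suc d) U \<and> ecount W + d * card U \<le> ecount U + d * card W"
  using assms
proof (induction "card W" arbitrary: W rule: less_induct)
  case less
  show ?case
  proof (cases "min_deg (Suc d) W")
    case True
    then show ?thesis using less.prems by auto
  next
    case False
    then obtain v where v: "v \<in> W" "card (nbrs W v) \<le> d"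
      by (auto simp: min_deg_def not_less_eq_eq)
    have "v \<notin> T"
    proof
      assume "v \<in> T"
      then have "Suc d \<le> card (nbrs T v)"
        using less.prems by (auto simp: min_deg_def)
      also have "\<dots> \<le> card (nbrs W v)"
        using less.prems by (intro card_nbrs_mono)
      finally show False using v by simp
    qed
    obtain m where m: "card W = Suc m" "card (W - {v}) = m"
      using v less.prems by (metis card.remove)
    obtain U where U: "T \<subseteq> U" "U \<subseteq> W - {v}" "min_deg (Suc d) U"
      "ecount (W - {v}) + d * card U \<le> ecount U + d * card (W - {v})"
    proof -
      have "card (W - {v}) < card W" "finite (W - {v})" "T \<subseteq> W - {v}"
        using m less.prems \<open>v \<notin> T\<close> by auto
      from less.hyps[OF this less.prems(3)] that show ?thesis by blast
    qed
    have "ecount W = ecount (W - {v}) + card (nbrs W v)"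
      using ecount_remove v less.prems by blast
    with U(4) have "ecount W + d * card U \<le> ecount U + d * card W"
      using v(2) unfolding m by simp
    with U show ?thesis by blast
  qed
qed

text \<open>A singleton \<open>X\<close> yields minimum degree above \<open>c\<close>, and
  \<open>X = U\<close>, for nonempty \<open>U\<close>, yields more than \<open>c * card U\<close>
  edges. Admitting every \<open>X\<close> makes the property pass to unions of components.\<close>

definition dense_core :: "nat \<Rightarrow> 'a set \<Rightarrow> bool" where
  "dense_core c U \<longleftrightarrow> (\<forall>X. X \<subseteq> U \<longrightarrow> X \<noteq> {} \<longrightarrow> ecount (U - X) + c * card X < ecount U)"

text \<open>Sets that violate the condition are deleted repeatedly;
  \<open>ecount U - c * card U\<close>, read as an integer, never decreases. The result may be
  empty, where the condition is vacuous.\<close>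

lemma ex_dense_core:
  assumes "finite W"
  shows "\<exists>U\<subseteq>W. dense_core c U \<and> ecount W + c * card U \<le> ecount U + c * card W"
  using assms
proof (induction "card W" arbitrary: W rule: less_induct)
  case less
  show ?case
  proof (cases "dense_core c W")
    case True
    then show ?thesis by auto
  next
    case False
    then obtain X where X: "X \<subseteq> W" "X \<noteq> {}" "ecount W \<le> ecount (W - X) + c * card X"
      by (auto simp: dense_core_def not_less)
    have fX: "finite X" using X less.prems finite_subset by auto
    obtain m where m: "card (W - X) = m" "card W = m + card X"
      using X less.prems fX
      by (metis add.commute card_Diff_subset card_mono le_add_diff_inverse)
    have "card X > 0" using X fX by (simp add: card_gt_0_iff)
    then have "card (W - X) < card W" "finite (W - X)" using m less.prems by simp_all
    from less.hyps[OF this] obtain U where U: "U \<subseteq> W - X" "dense_core c U"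
      "ecount (W - X) + c * card U \<le> ecount U + c * card (W - X)"
      by blast
    with X(3) have "ecount W + c * card U \<le> ecount U + c * card W"
      unfolding m by (simp add: algebra_simps)
    with U show ?thesis by blast
  qed
qed

lemma dense_core_min_deg:
  assumes "dense_core c U" "finite U"
  shows "min_deg (Suc c) U"
  unfolding min_deg_def
proof
  fix v assume v: "v \<in> U"
  have "ecount (U - {v}) + c * card {v} < ecount U"
    using assms v unfolding dense_core_def by blast
  then show "Suc c \<le> card (nbrs U v)"
    using ecount_remove[of U v] v assms by simp
qed

lemma dense_core_card:
  assumes "dense_core c U" "finite U" "U \<noteq> {}"
  shows "2 * c + 2 \<le> card U"
proof -
  have "c * card U < ecount U"
    using assms unfolding dense_core_def by (metis Diff_cancel add.left_neutral ecount_empty order_refl)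
  then have "card U * (2 * c) < card U * (card U - 1)"
    using ecount_le_pairs[OF assms(2)] by (simp add: algebra_simps)
  then have "2 * c < card U - 1"
    by (simp only: mult_less_cancel1)
  then show ?thesis by simp
qed


section \<open>Long paths\<close>

definition path_in :: "'a set \<Rightarrow> 'a list \<Rightarrow> bool" where
  "path_in W p \<longleftrightarrow> p \<noteq> [] \<and> distinct p \<and> set p \<subseteq> W \<and> successively adj p"

text \<open>Stated through edges leaving a set, because it is used to step out of a cycle, or out of
  the set of vertices reached so far.\<close>

definition conn :: "'a set \<Rightarrow> bool" where
  "conn W \<longleftrightarrow> (\<forall>X. X \<subseteq> W \<longrightarrow> X \<noteq> {} \<longrightarrow> X \<noteq> W \<longrightarrow> (\<exists>x\<in>X. \<exists>y\<in>W - X. adj x y))"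

text \<open>Two adjacent vertices form a cycle in this sense, so no lower bound on lengths has to be
  carried along.\<close>

definition cycle_in :: "'a set \<Rightarrow> 'a list \<Rightarrow> bool" where
  "cycle_in W c \<longleftrightarrow> path_in W c \<and> adj (last c) (hd c)"

lemma path_in_length: "path_in W p \<Longrightarrow> finite W \<Longrightarrow> length p \<le> card W"
  unfolding path_in_def by (metis card_mono distinct_card)

lemma path_in_mono: "path_in X p \<Longrightarrow> X \<subseteq> W \<Longrightarrow> path_in W p"
  by (auto simp: path_in_def)

lemma successively_adj_flip [simp]: "successively (\<lambda>x y. adj y x) p \<longleftrightarrow> successively adj p"
proof -
  have "(\<lambda>x y. adj y x) = adj"
    by (intro ext iffI) (erule adj_sym)+
  then show ?thesis
    by (rule arg_cong[where f = "\<lambda>r. successively r p"])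
qed

lemma path_in_rev [simp]: "path_in W (rev p) \<longleftrightarrow> path_in W p"
  by (simp add: path_in_def)

lemma path_in_Cons:
  "path_in W (x # p) \<longleftrightarrow> x \<in> W \<and> x \<notin> set p \<and> (p = [] \<or> path_in W p \<and> adj x (hd p))"
  by (auto simp: path_in_def successively_Cons)

lemma path_in_append:
  assumes "path_in W p" "path_in W q" "set p \<inter> set q = {}" "adj (last p) (hd q)"
  shows "path_in W (p @ q)"
  using assms by (auto simp: path_in_def successively_append_iff)

lemma path_in_take:
  assumes "path_in W p" "0 < m"
  shows "path_in W (take m p)"
proof -
  have "successively adj (take m p @ drop m p)"
    using assms by (simp add: path_in_def)
  then have "successively adj (take m p)"
    unfolding successively_append_iff by blast
  with assms show ?thesis
    by (auto simp: path_in_def dest: in_set_takeD)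
qed

lemma path_in_drop:
  assumes "path_in W p" "m < length p"
  shows "path_in W (drop m p)"
proof -
  have "successively adj (take m p @ drop m p)"
    using assms by (simp add: path_in_def)
  then have "successively adj (drop m p)"
    unfolding successively_append_iff by blast
  with assms show ?thesis
    by (auto simp: path_in_def dest: in_set_dropD)
qed

lemma cycle_in_rotate1:
  assumes "cycle_in W c"
  shows "cycle_in W (rotate1 c)"
proof (cases c)
  case (Cons x xs)
  show ?thesis
  proof (cases "xs = []")
    case False
    with Cons assms have "successively adj xs" "adj x (hd xs)" "adj (last xs) x"
      by (auto simp: cycle_in_def path_in_def successively_Cons)
    with False Cons assms show ?thesis
      by (auto simp: cycle_in_def path_in_def successively_append_iff)
  qed (use Cons assms in simp)
qed (use assms in simp)

lemma cycle_in_rotate: "cycle_in W c \<Longrightarrow> cycle_in W (rotate n c)"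
  by (induction n) (auto simp: cycle_in_rotate1)

lemma cycle_in_rotate_hd:
  assumes "cycle_in W c" "x \<in> set c"
  obtains c' where "cycle_in W c'" "set c' = set c" "length c' = length c" "hd c' = x"
proof -
  obtain i where i: "i < length c" "c ! i = x"
    using assms by (auto simp: in_set_conv_nth)
  have "hd (rotate i c) = x"
    using i by (subst hd_rotate_conv_nth) auto
  with cycle_in_rotate[OF assms(1), of i] that[of "rotate i c"] show ?thesis
    by simp
qed

section \<open>Counting positions of neighbours along a path\<close>

lemma card_nth_indices:
  assumes "distinct c" "S \<subseteq> set c"
  shows "card {a. a < length c \<and> c ! a \<in> S} = card S"
proof -
  have "(\<lambda>a. c ! a) ` {a. a < length c \<and> c ! a \<in> S} = S"
  proof
    show "S \<subseteq> (\<lambda>a. c ! a) ` {a. a < length c \<and> c ! a \<in> S}"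
    proof
      fix x assume x: "x \<in> S"
      then obtain a where "a < length c" "c ! a = x"
        using assms(2) by (metis in_set_conv_nth subsetD)
      with x show "x \<in> (\<lambda>a. c ! a) ` {a. a < length c \<and> c ! a \<in> S}"
        by auto
    qed
  qed auto
  moreover have "inj_on (\<lambda>a. c ! a) {a. a < length c \<and> c ! a \<in> S}"
    using assms(1) by (auto simp: inj_on_def nth_eq_iff_index_eq)
  ultimately show ?thesis
    by (metis card_image)
qed

text \<open>Pigeonhole on the \<open>m - 1\<close> gaps of a list of length \<open>m\<close>, gap
  \<open>a\<close> lying between positions \<open>a - 1\<close> and \<open>a\<close>. In its uses
  one set marks gaps by their right end, the other by their left end.\<close>

lemma overlapping_indices:
  assumes "A \<subseteq> {1..<m}" "B \<subseteq> {1..<m}" "m \<le> card A + card B" "0 < m"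
  shows "\<exists>a. a \<in> A \<and> a \<in> B"
proof -
  have "finite A" "finite B"
    using assms finite_subset by blast+
  have "A \<inter> B \<noteq> {}"
  proof
    assume "A \<inter> B = {}"
    then have "card A + card B = card (A \<union> B)"
      using \<open>finite A\<close> \<open>finite B\<close> by (simp add: card_Un_disjoint)
    also have "\<dots> \<le> card {1..<m}"
      using assms by (intro card_mono) auto
    finally show False using assms by simp
  qed
  then show ?thesis by blast
qed

lemma card_hd_nbr_indices:
  assumes "distinct p" "p \<noteq> []" "N \<subseteq> set p" "hd p \<notin> N"
  shows "card {a \<in> {1..<length p}. p ! a \<in> N} = card N"
proof -
  have "{a \<in> {1..<length p}. p ! a \<in> N} = {a. a < length p \<and> p ! a \<in> N}"
    using assms by (auto simp: hd_conv_nth Suc_le_eq intro!: Nat.gr0I)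
  then show ?thesis
    using card_nth_indices assms by simp
qed

lemma card_shifted_indices:
  assumes "distinct p" "p \<noteq> []" "N \<subseteq> set p" "last p \<notin> N"
  shows "card {a \<in> {1..<length p}. p ! (a - 1) \<in> N} = card N"
proof -
  have "bij_betw Suc {a. a < length p \<and> p ! a \<in> N} {a \<in> {1..<length p}. p ! (a - 1) \<in> N}"
  proof (rule bij_betw_byWitness[where f' = "\<lambda>a. a - 1"])
    have "Suc a < length p" if "a < length p" "p ! a \<in> N" for a
    proof -
      have "a \<noteq> length p - 1"
        using that assms(4) assms(2) by (auto simp: last_conv_nth)
      with that show ?thesis by simp
    qed
    then show "Suc ` {a. a < length p \<and> p ! a \<in> N} \<subseteq> {a \<in> {1..<length p}. p ! (a - 1) \<in> N}"
      by auto
  qed auto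
  from bij_betw_same_card[OF this] card_nth_indices[OF assms(1,3)]
  show ?thesis by (rule trans[OF sym])
qed

lemma conn_leaves:
  assumes "conn W" "X \<subseteq> W" "X \<noteq> {}" "X \<noteq> W"
  obtains x y where "x \<in> X" "y \<in> W - X" "adj x y"
  using assms unfolding conn_def by blast

lemma last_take: "0 < a \<Longrightarrow> a \<le> length p \<Longrightarrow> last (take a p) = p ! (a - 1)"
  by (subst last_conv_nth) auto

text \<open>Follow the path to position \<open>a - 1\<close>, jump to its last vertex, come back to
  position \<open>b\<close> and return to the head. With \<open>a = b\<close> the cycle contains all
  of \<open>p\<close>; with \<open>b = Suc a\<close> it misses exactly \<open>p ! a\<close>.\<close>

lemma path_in_cross:
  assumes p: "path_in W p" and ab: "0 < a" "a \<le> b" "b < length p"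
    and adj: "adj (hd p) (p ! b)" "adj (last p) (p ! (a - 1))"
  shows "cycle_in W (take a p @ rev (drop b p))"
proof -
  have ne: "p \<noteq> []" "p ! (a - 1) = last (take a p)" "p ! b = hd (drop b p)"
    using ab by (auto simp: last_take hd_drop_conv_nth)
  have "path_in W (take a p @ rev (drop b p))"
  proof (rule path_in_append)
    show "set (take a p) \<inter> set (rev (drop b p)) = {}"
      using p ab by (simp add: path_in_def set_take_disj_set_drop_if_distinct)
    show "adj (last (take a p)) (hd (rev (drop b p)))"
      using adj(2) ne ab adj_sym by (simp add: hd_rev)
  qed (use p ab in \<open>auto simp: path_in_take path_in_drop\<close>)
  moreover have "adj (last (take a p @ rev (drop b p))) (hd (take a p @ rev (drop b p)))"
    using adj(1) ne ab adj_sym by (simp add: last_rev)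
  ultimately show ?thesis by (simp add: cycle_in_def)
qed

lemma cycle_in_extend:
  assumes "cycle_in W c" "conn W" "length c < card W" "finite W"
  obtains p where "path_in W p" "length p = Suc (length c)"
proof -
  have c: "set c \<subseteq> W" "set c \<noteq> {}" "card (set c) = length c"
    using assms(1) by (auto simp: cycle_in_def path_in_def distinct_card)
  then have "set c \<noteq> W" using assms(3) by auto
  with conn_leaves[OF assms(2)] c obtain x y where xy: "x \<in> set c" "y \<in> W - set c" "adj x y"
    by metis
  obtain c' where c': "cycle_in W c'" "set c' = set c" "length c' = length c" "hd c' = x"
    using cycle_in_rotate_hd[OF assms(1) xy(1)] by blast
  then have "path_in W (y # c')"
    using xy adj_sym by (auto simp: path_in_Cons cycle_in_def)
  with that c' show ?thesis by simp
qed

text \<open>A longest path \<open>P\<close> starting in \<open>T\<close> closes up to a cycle by degree counting. If the last vertex of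
  that cycle had a neighbour outside the cycle, then so would the first one, which moreover would
  not be in \<open>T\<close>; going around the cycle, \<open>T\<close> would avoid it altogether.\<close>

lemma long_path:
  assumes fin: "finite K" and con: "conn K" and degK: "min_deg s K"
    and T: "T \<subseteq> K" "T \<noteq> {}" and degT: "min_deg t T"
    and m: "m \<le> card K" "m \<le> s + t + 1" "0 < m"
  obtains p where "path_in K p" "length p = m"
proof -
  let ?Q = "\<lambda>p. path_in K p \<and> hd p \<in> T"
  obtain x0 where "x0 \<in> T" using T by blast
  then have "?Q [x0]" using T by (auto simp: path_in_def)
  moreover have "\<And>p. ?Q p \<Longrightarrow> length p < Suc (card K)"
    using path_in_length[OF _ fin] by (simp add: less_Suc_eq_le)
  ultimately obtain P where P: "?Q P" and Pmax: "\<And>q. ?Q q \<Longrightarrow> length q \<le> length P"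
    using ex_has_greatest_nat[of ?Q "[x0]" length "Suc (card K)"] by blast
  \<comment> \<open>Reversal extends the maximality to paths that end in \<open>T\<close>.\<close>
  have no_longer: False if "path_in K q" "length q = Suc (length P)" "hd q \<in> T \<or> last q \<in> T" for q
  proof (cases "hd q \<in> T")
    case True
    then show ?thesis using Pmax[of q] that by auto
  next
    case False
    then have "?Q (rev q)" using that by (auto simp: hd_rev path_in_def)
    then show ?thesis using Pmax[of "rev q"] that by auto
  qed
  define k where "k = length P"
  have "m \<le> k"
  proof (rule ccontr)
    assume "\<not> m \<le> k"
    then have k: "k < card K" "k \<le> s + t" using m by auto
    have Pne: "P \<noteq> []" "distinct P" "set P \<subseteq> K" "0 < k" using P by (auto simp: path_in_def k_def)
    \<comment> \<open>Prepending \<open>x\<close> keeps the head in \<open>T\<close> only for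
      \<open>x\<close> in \<open>T\<close>, so at this end only neighbours in \<open>T\<close> are
      controlled; at the other end all neighbours in \<open>K\<close> are.\<close>
    have hdN: "nbrs T (hd P) \<subseteq> set P"
    proof
      fix x assume "x \<in> nbrs T (hd P)"
      then have x: "x \<in> T" "adj x (hd P)" using adj_sym by (auto simp: nbrs_def)
      show "x \<in> set P"
      proof (rule ccontr)
        assume "x \<notin> set P"
        then have "path_in K (x # P)" using x T P by (auto simp: path_in_Cons)
        then show False using no_longer[of "x # P"] x by simp
      qed
    qed
    have lastN: "nbrs K (last P) \<subseteq> set P"
    proof
      fix x assume "x \<in> nbrs K (last P)"
      then have x: "x \<in> K" "adj (last P) x" using adj_sym by (auto simp: nbrs_def)
      show "x \<in> set P"
      proof (rule ccontr)
        assume "x \<notin> set P"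
        then have "path_in K (P @ [x])"
          using x P by (intro path_in_append) (auto simp: path_in_def)
        then show False using no_longer[of "P @ [x]"] P Pne by simp
      qed
    qed
    let ?A = "{a \<in> {1..<length P}. P ! a \<in> nbrs T (hd P)}"
    let ?B = "{a \<in> {1..<length P}. P ! (a - 1) \<in> nbrs K (last P)}"
    have "last P \<in> K" using Pne last_in_set by blast
    then have "t \<le> card (nbrs T (hd P))" "s \<le> card (nbrs K (last P))"
      using degT degK P Pne by (auto simp: min_deg_def)
    then have "t \<le> card ?A" "s \<le> card ?B"
      using card_hd_nbr_indices[OF _ _ hdN] card_shifted_indices[OF _ _ lastN] Pne by auto
    then have "length P \<le> card ?A + card ?B" using k by (simp add: k_def)
    then have "\<exists>a. a \<in> ?A \<and> a \<in> ?B"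
      using Pne(1) by (intro overlapping_indices[of _ "length P"]) (blast | simp)+
    then obtain a where a: "a \<in> ?A" "a \<in> ?B" by blast
    define c0 where "c0 = take a P @ rev (drop a P)"
    have c0: "cycle_in K c0"
      unfolding c0_def using P a by (intro path_in_cross) (auto simp: nbrs_def)
    have setc0: "set c0 = set P"
      unfolding c0_def by (metis append_take_drop_id set_append set_rev)
    have lenc0: "length c0 = k" using a by (auto simp: c0_def k_def)
    \<comment> \<open>The vertex beyond the \<open>t\<close> neighbours is the head of
      \<open>P\<close> itself. It makes up for the exclusion of \<open>last c\<close> in the count
      below.\<close>
    have Tc: "Suc t \<le> card (T \<inter> set P)"
    proof -
      have "insert (hd P) (nbrs T (hd P)) \<subseteq> T \<inter> set P"
        using hdN P Pne by (auto simp: nbrs_def)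
      then have "card (insert (hd P) (nbrs T (hd P))) \<le> card (T \<inter> set P)"
        by (intro card_mono) auto
      moreover have "card (insert (hd P) (nbrs T (hd P))) = Suc (card (nbrs T (hd P)))"
        using finite_nbrs[OF finite_subset[OF T(1) fin]] by simp
      ultimately show ?thesis using \<open>t \<le> card (nbrs T (hd P))\<close> by linarith
    qed
    have step: "hd c \<notin> T \<and> (\<exists>w\<in>K - set c. adj (hd c) w)"
      if c: "cycle_in K c" "set c = set P" "length c = k" and w: "w \<in> K - set c" "adj (last c) w" for c w
    proof
      have cp: "path_in K c" "c \<noteq> []" "distinct c" using c by (auto simp: cycle_in_def path_in_def)
      have pw: "path_in K [w]" using w by (simp add: path_in_def)
      have "path_in K (c @ [w])"
        using cp w pw by (intro path_in_append) auto
      then show hdT: "hd c \<notin> T"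
        using no_longer[of "c @ [w]"] c cp by (auto simp: k_def)
      show "\<exists>w\<in>K - set c. adj (hd c) w"
      proof (rule ccontr)
        assume "\<not> ?thesis"
        then have hdN': "nbrs K (hd c) \<subseteq> set c" by (auto simp: nbrs_def)
        let ?A = "{a \<in> {1..<length c}. c ! a \<in> nbrs K (hd c)}"
        let ?B = "{a \<in> {1..<length c}. c ! (a - 1) \<in> T \<inter> set P - {last c}}"
        have "hd c \<in> K" using cp hd_in_set by (auto simp: path_in_def)
        then have "s \<le> card (nbrs K (hd c))" using degK by (auto simp: min_deg_def)
        then have "s \<le> card ?A"
          using card_hd_nbr_indices[OF _ _ hdN'] cp by auto
        moreover have "t \<le> card (T \<inter> set P - {last c})"
          using Tc diff_card_le_card_Diff[of "{last c}" "T \<inter> set P"] by simp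
        moreover have "card ?B = card (T \<inter> set P - {last c})"
          using cp c(2) by (intro card_shifted_indices) auto
        ultimately have "length c \<le> card ?A + card ?B"
          using k c(3) by linarith
        then have "\<exists>b. b \<in> ?A \<and> b \<in> ?B"
          using cp(2) by (intro overlapping_indices[of _ "length c"]) (blast | simp)+
        then obtain b where b: "b \<in> ?A" "b \<in> ?B" by blast
        have b': "0 < b" "b < length c" using b by auto
        \<comment> \<open>Reversing the part before position \<open>b\<close> brings
          \<open>c ! (b - 1)\<close>, a vertex of \<open>T\<close>, to the front and keeps the
          neighbour of \<open>w\<close> at the end.\<close>
        have q: "path_in K (rev (take b c) @ drop b c)"
        proof (rule path_in_append)
          show "set (rev (take b c)) \<inter> set (drop b c) = {}"
            using cp by (simp add: set_take_disj_set_drop_if_distinct)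
          show "adj (last (rev (take b c))) (hd (drop b c))"
            using b b' by (simp add: last_rev hd_drop_conv_nth nbrs_def)
        qed (use cp b' in \<open>auto simp: path_in_take path_in_drop\<close>)
        have "set (rev (take b c) @ drop b c) = set c"
          by (metis append_take_drop_id set_append set_rev)
        then have "path_in K ((rev (take b c) @ drop b c) @ [w])"
          using w b' by (intro path_in_append[OF q pw]) (simp_all del: set_append)
        moreover have "hd ((rev (take b c) @ drop b c) @ [w]) = c ! (b - 1)"
          using b' cp(2) by (simp add: hd_append hd_rev last_take)
        ultimately show False
          using no_longer[of "(rev (take b c) @ drop b c) @ [w]"] b b' c(3) by (simp add: k_def)
      qed
    qed
    have "card (set P) = k" using Pne by (simp add: k_def distinct_card)
    then have "set P \<noteq> K" using k by auto
    then obtain x w0 where xw: "x \<in> set P" "w0 \<in> K - set P" "adj x w0"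
      using conn_leaves[OF con, of "set P"] Pne by auto
    obtain c1 where c1: "cycle_in K c1" "set c1 = set P" "length c1 = k" "hd c1 = x"
      using cycle_in_rotate_hd[OF c0] xw setc0 lenc0 by metis
    \<comment> \<open>Avoidance of \<open>T\<close> is obtained for the head only after a rotation,
      hence \<open>0 < j\<close>; going round once more, to \<open>k + i\<close>, covers position 0
      as well.\<close>
    have inv: "\<exists>w\<in>K - set P. adj (hd (rotate j c1)) w \<and> (0 < j \<longrightarrow> hd (rotate j c1) \<notin> T)" for j
    proof (induction j)
      case 0
      then show ?case using xw c1 by auto
    next
      case (Suc j)
      let ?c = "rotate (Suc j) c1"
      have ne: "c1 \<noteq> []" using c1 Pne by auto
      have "last ?c = hd (rotate j c1)"
        using ne by (cases "rotate j c1") auto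
      with Suc obtain w where "w \<in> K - set ?c" "adj (last ?c) w"
        using c1 by auto
      then show ?case
        using step[of ?c w] cycle_in_rotate[OF c1(1), of "Suc j"] c1 by auto
    qed
    have "y \<notin> T" if y: "y \<in> set P" for y
    proof -
      obtain i where i: "i < k" "c1 ! i = y"
        using y c1(2,3) by (metis in_set_conv_nth)
      have "c1 \<noteq> []" using c1(2) y by auto
      with i c1(3) have "hd (rotate (k + i) c1) = y"
        by (subst hd_rotate_conv_nth) auto
      moreover have "0 < k + i" using Pne by simp
      ultimately show ?thesis using inv[of "k + i"] by blast
    qed
    then show False using P Pne by auto
  qed
  then have "path_in K (take m P)" "length (take m P) = m"
    using P m by (auto simp: path_in_take k_def)
  then show ?thesis using that by blast
qed


section \<open>Splitting disconnected sets and joining disjoint ones by paths\<close>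

lemma not_conn_split:
  assumes "\<not> conn W"
  obtains X Y where "X \<noteq> {}" "Y \<noteq> {}" "X \<union> Y = W" "X \<inter> Y = {}" "\<And>x y. x \<in> X \<Longrightarrow> y \<in> Y \<Longrightarrow> \<not> adj x y"
proof -
  obtain X where X: "X \<subseteq> W" "X \<noteq> {}" "X \<noteq> W" "\<And>x y. x \<in> X \<Longrightarrow> y \<in> W - X \<Longrightarrow> \<not> adj x y"
    using assms unfolding conn_def by blast
  show ?thesis
    by (rule that[of X "W - X"]) (use X in auto)
qed

text \<open>The path grows at its head while \<open>x\<close> stays last; as long as it has at most
  \<open>d\<close> vertices, the head has a neighbour off the path.\<close>

lemma greedy_path:
  assumes "finite T" "min_deg d T" "x \<in> T"
  obtains p where "path_in T p" "last p = x" "length p = Suc d"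
proof -
  have "\<exists>p. path_in T p \<and> last p = x \<and> length p = Suc k" if "k \<le> d" for k
    using that
  proof (induction k)
    case 0
    then show ?case using assms by (intro exI[of _ "[x]"]) (simp add: path_in_def)
  next
    case (Suc k)
    then obtain p where p: "path_in T p" "last p = x" "length p = Suc k" by auto
    have hd: "hd p \<in> T" "hd p \<in> set p" using p by (auto simp: path_in_def)
    have "\<not> nbrs T (hd p) \<subseteq> set p - {hd p}"
    proof
      assume "nbrs T (hd p) \<subseteq> set p - {hd p}"
      then have "card (nbrs T (hd p)) \<le> card (set p - {hd p})" by (intro card_mono) auto
      also have "\<dots> = k" using p hd by (simp add: path_in_def distinct_card)
      also have "k < d" using Suc by simp
      finally show False using assms(2) hd by (auto simp: min_deg_def)
    qed
    then obtain y where "y \<in> T" "adj (hd p) y" "y \<notin> set p"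
      by (auto simp: nbrs_def)
    then have "path_in T (y # p)" "last (y # p) = x" "length (y # p) = Suc (Suc k)"
      using p adj_sym by (auto simp: path_in_Cons)
    then show ?case by blast
  qed
  then show ?thesis using that by blast
qed

lemma conn_path:
  assumes "conn W" "T \<subseteq> W" "K \<subseteq> W" "T \<noteq> {}" "K \<noteq> {}"
  obtains p where "path_in W p" "hd p \<in> T" "last p \<in> K"
proof -
  define X where "X = {v. \<exists>p. path_in W p \<and> hd p \<in> T \<and> last p = v}"
  have "T \<subseteq> X"
  proof
    fix x assume "x \<in> T"
    then have "path_in W [x]" using assms by (auto simp: path_in_def)
    with \<open>x \<in> T\<close> show "x \<in> X" by (force simp: X_def)
  qed
  have "X \<subseteq> W" by (auto simp: X_def path_in_def)
  have "X = W"
  proof (rule ccontr)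
    assume "X \<noteq> W"
    then obtain x y where xy: "x \<in> X" "y \<in> W - X" "adj x y"
      using conn_leaves[OF assms(1) \<open>X \<subseteq> W\<close>] \<open>T \<subseteq> X\<close> assms(4) by blast
    then obtain p where p: "path_in W p" "hd p \<in> T" "last p = x" by (auto simp: X_def)
    have "y \<in> X"
    proof (cases "y \<in> set p")
      case True
      then obtain i where i: "i < length p" "p ! i = y" by (auto simp: in_set_conv_nth)
      then have "path_in W (take (Suc i) p)" "hd (take (Suc i) p) \<in> T" "last (take (Suc i) p) = y"
        using p by (auto simp: path_in_take last_take)
      then show ?thesis by (auto simp: X_def)
    next
      case False
      have "path_in W (p @ [y])"
        using p xy False by (intro path_in_append) (auto simp: path_in_def)
      moreover have "hd (p @ [y]) \<in> T" using p by (simp add: path_in_def)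
      ultimately show ?thesis unfolding X_def by (metis (mono_tags, lifting) last_snoc mem_Collect_eq)
    qed
    with xy show False by simp
  qed
  moreover obtain k where "k \<in> K" using assms(5) by blast
  ultimately have "k \<in> X" using assms(3) by blast
  with \<open>k \<in> K\<close> show ?thesis using that by (auto simp: X_def)
qed

text \<open>A shortest path from \<open>T\<close> to \<open>K\<close> has its interior outside both
  sets, so greedy paths inside \<open>T\<close> and \<open>K\<close> that end at its two end
  vertices can be attached. They account for \<open>t + 1\<close> and \<open>s + 1\<close>
  vertices.\<close>

lemma join_paths:
  assumes con: "conn W" and fin: "finite W" and sub: "T \<subseteq> W" "K \<subseteq> W" "T \<noteq> {}" "K \<noteq> {}" "T \<inter> K = {}"
    and deg: "min_deg t T" "min_deg s K"
  obtains p where "path_in W p" "t + s + 2 \<le> length p"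
proof -
  let ?Q = "\<lambda>p. path_in W p \<and> hd p \<in> T \<and> last p \<in> K"
  obtain p0 where "?Q p0" using conn_path[OF con sub(1-4)] by blast
  then obtain q where q: "?Q q" and qmin: "\<And>p. ?Q p \<Longrightarrow> length q \<le> length p"
    using ex_has_least_nat[of ?Q p0 length] by blast
  have fin': "finite T" "finite K" using finite_subset[OF _ fin] sub by blast+
  have qne: "q \<noteq> []" "tl q \<noteq> []"
    using q sub by (cases q; cases "tl q"; force simp: path_in_def)+
  obtain a r where ar: "q = a # r" "r \<noteq> []" using qne by (cases q) auto
  obtain m b where mb: "r = m @ [b]" using ar(2) by (cases r rule: rev_cases) auto
  have qeq: "q = a # m @ [b]" using ar mb by simp
  have ab: "a \<in> T" "b \<in> K" using q qeq by auto
  have mT: "x \<notin> T \<and> x \<notin> K" if x: "x \<in> set m" for x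
  proof -
    obtain m1 m2 where m: "m = m1 @ x # m2" using x by (meson split_list)
    have "path_in W (x # m2 @ [b])" "path_in W (a # m1 @ [x])"
      using q qeq m by (auto simp: path_in_def successively_append_iff successively_Cons hd_append)
    then show ?thesis
      using qmin[of "x # m2 @ [b]"] qmin[of "a # m1 @ [x]"] ab qeq m by auto
  qed
  obtain p1 where p1: "path_in T p1" "last p1 = a" "length p1 = Suc t"
    using greedy_path[OF fin'(1) deg(1) ab(1)] by blast
  obtain p2 where p2: "path_in K p2" "last p2 = b" "length p2 = Suc s"
    using greedy_path[OF fin'(2) deg(2) ab(2)] by blast
  have ne: "p1 \<noteq> []" "p2 \<noteq> []" using p1 p2 by auto
  have s: "set p1 \<subseteq> T" "set p2 \<subseteq> K" "distinct p1" "distinct p2" using p1 p2 by (auto simp: path_in_def)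
  have "path_in W (p1 @ m @ rev p2)"
    unfolding path_in_def
  proof (intro conjI)
    show "distinct (p1 @ m @ rev p2)"
      using s mT sub(5) q qeq by (auto simp: path_in_def)
    show "set (p1 @ m @ rev p2) \<subseteq> W"
      using s sub q qeq by (auto simp: path_in_def)
    show "successively adj (p1 @ m @ rev p2)"
      using p1 p2 q qeq ne
      by (cases "m = []") (auto simp: path_in_def successively_append_iff successively_Cons hd_rev hd_append)
  qed (use ne in auto)
  then show ?thesis using that[of "p1 @ m @ rev p2"] p1 p2 by simp
qed

text \<open>Deleting vertices of one side leaves the edges of the other untouched, so these cancel
  from the inequality for \<open>U\<close>.\<close>

lemma dense_core_split:
  assumes "dense_core c U" "finite U" "\<not> conn U"
  obtains X Y where "X \<union> Y = U" "X \<inter> Y = {}" "X \<noteq> {}" "Y \<noteq> {}" "dense_core c X" "dense_core c Y"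
proof -
  obtain X Y where XY: "X \<noteq> {}" "Y \<noteq> {}" "X \<union> Y = U" "X \<inter> Y = {}" "\<And>x y. x \<in> X \<Longrightarrow> y \<in> Y \<Longrightarrow> \<not> adj x y"
    using not_conn_split[OF assms(3)] by blast
  have part: "dense_core c A" if AB: "A \<union> B = U" "A \<inter> B = {}" and no: "\<And>x y. x \<in> A \<Longrightarrow> y \<in> B \<Longrightarrow> \<not> adj x y" for A B
    unfolding dense_core_def
  proof (intro allI impI)
    fix Z assume Z: "Z \<subseteq> A" "Z \<noteq> {}"
    have "U - Z = (A - Z) \<union> B" using AB Z by auto
    moreover have fin: "finite A" "finite B" using AB assms(2) by auto
    ultimately have "ecount (U - Z) = ecount (A - Z) + ecount B"
      using AB no by (auto intro!: ecount_Un_no_cross)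
    moreover have "ecount U = ecount A + ecount B"
      using AB no fin ecount_Un_no_cross[of A B] by auto
    moreover have "ecount (U - Z) + c * card Z < ecount U"
      using assms(1) Z AB unfolding dense_core_def by blast
    ultimately show "ecount (A - Z) + c * card Z < ecount A" by simp
  qed
  have "dense_core c X" using part[of X Y] XY by blast
  moreover have "dense_core c Y"
    by (rule part[of Y X]) (use XY adj_sym in blast)+
  ultimately show ?thesis using that XY by blast
qed

text \<open>Passing to one side of a split keeps the property and ends in a connected set. There
  minimum degree \<open>c + 1\<close> suffices, as at least \<open>2 * c + 2\<close> vertices are
  present.\<close>

lemma dense_core_path:
  assumes "dense_core c U" "finite U" "U \<noteq> {}"
  shows "\<exists>p. path_in U p \<and> length p = 2 * c + 2"
  using assms
proof (induction "card U" arbitrary: U rule: less_induct)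
  case less
  show ?case
  proof (cases "conn U")
    case True
    have "2 * c + 2 \<le> card U" "min_deg (Suc c) U"
      using dense_core_card dense_core_min_deg less.prems by auto
    then show ?thesis
      using long_path[OF less.prems(2) True, of "Suc c" U "Suc c" "2 * c + 2"] less.prems by auto
  next
    case False
    then obtain X Y where XY: "X \<union> Y = U" "X \<inter> Y = {}" "X \<noteq> {}" "Y \<noteq> {}" "dense_core c X"
      using dense_core_split less.prems by metis
    have "X \<subset> U" using XY by blast
    then have "card X < card U" "finite X"
      using less.prems psubset_card_mono finite_subset by auto
    then obtain p where "path_in X p" "length p = 2 * c + 2" using less.hyps XY by blast
    moreover have "path_in U p" using \<open>X \<subset> U\<close> calculation by (auto intro: path_in_mono)
    ultimately show ?thesis by blast
  qed
qed

section \<open>The extremal graph\<close>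

text \<open>\<open>V\<close> carries the join of a complete graph on \<open>S\<close> and an
  edgeless graph on the rest.\<close>

definition extremal :: "nat \<Rightarrow> 'a set \<Rightarrow> bool" where
  "extremal s V \<longleftrightarrow> (\<exists>S\<subseteq>V. card S = s \<and> induced V = {e. e \<subseteq> V \<and> card e = 2 \<and> e \<inter> S \<noteq> {}})"

text \<open>The neighbourhoods outside \<open>S\<close> determine every edge that is not inside
  \<open>S\<close>; the edge count then forces \<open>S\<close> to be complete.\<close>

lemma extremalI:
  assumes fin: "finite V" and S: "S \<subseteq> V" and N: "\<And>v. v \<in> V - S \<Longrightarrow> nbrs V v = S"
    and e: "2 * card S * card V \<le> 2 * ecount V + card S * (card S + 1)"
  shows "extremal (card S) V"
proof -
  define s where "s = card S"
  have finS: "finite S" using S fin finite_subset by auto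
  have "nbrs (V - S) v = {}" if "v \<in> V - S" for v
    using N[OF that] by (auto simp: nbrs_def)
  then have "ecount (V - S) = 0"
    using handshake[of "V - S"] fin by simp
  moreover have "nbrs S v = S" if "v \<in> V - S" for v
    using N[OF that] S by (auto simp: nbrs_def)
  then have "(\<Sum>v\<in>V - S. card (nbrs S v)) = card (V - S) * s"
    by (simp add: s_def)
  moreover have "ecount V \<le> ecount (V - S) + ecount S + (\<Sum>v\<in>V - S. card (nbrs S v))"
    using ecount_Un_le[of "V - S" S] fin finS S by (auto simp: Un_absorb2)
  ultimately have "ecount V \<le> ecount S + card (V - S) * s" by simp
  moreover obtain r where r: "card V = s + r" "card (V - S) = r"
    using S fin finS by (metis card_Diff_subset card_mono le_add_diff_inverse s_def)
  ultimately have "s * s \<le> 2 * ecount S + s"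
    using e unfolding r s_def[symmetric] by (simp add: algebra_simps)
  then have "s * (s - 1) \<le> 2 * ecount S"
    by (cases s) auto
  then have "s choose 2 \<le> ecount S" by (simp add: choose_two)
  then have "card {e. e \<subseteq> S \<and> card e = 2} \<le> card (induced S)"
    using n_subsets[OF finS, of 2] by (simp add: ecount_def s_def)
  moreover have "induced S \<subseteq> {e. e \<subseteq> S \<and> card e = 2}"
    using card_edge by (auto simp: induced_def)
  ultimately have "induced S = {e. e \<subseteq> S \<and> card e = 2}"
    using finS by (intro card_seteq) auto
  then have full: "{a, b} \<in> E" if "a \<in> S" "b \<in> S" "a \<noteq> b" for a b
    using that by (auto simp: induced_def)
  have out: "adj a b" if "a \<in> V - S" "b \<in> S" for a b
    using N[OF that(1)] that(2) by (auto simp: nbrs_def)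
  have "induced V = {e. e \<subseteq> V \<and> card e = 2 \<and> e \<inter> S \<noteq> {}}" (is "?L = ?R")
  proof (intro set_eqI iffI)
    fix e assume e: "e \<in> ?L"
    then obtain a b where ab: "e = {a, b}" "a \<noteq> b" "a \<in> V" "b \<in> V"
      using card_edge[of e] by (auto simp: induced_def card_2_iff)
    have "a \<in> S \<or> b \<in> S"
    proof (rule ccontr)
      assume "\<not> ?thesis"
      moreover have "b \<in> nbrs V a" using e ab by (auto simp: induced_def nbrs_def adj_def)
      ultimately show False using N[of a] ab by auto
    qed
    with e ab show "e \<in> ?R" by (auto simp: induced_def)
  next
    fix e assume e: "e \<in> ?R"
    then obtain a b where ab: "e = {a, b}" "a \<noteq> b" "a \<in> V" "b \<in> V"
      by (auto simp: card_2_iff)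
    have "{a, b} \<in> E"
      using e ab full[of a b] out[of a b] out[of b a] adj_sym by (auto simp: adj_def)
    with e ab show "e \<in> ?L" by (auto simp: induced_def)
  qed
  then show ?thesis using S by (auto simp: extremal_def)
qed

subsection \<open>Uniqueness for connected graphs without long paths\<close>

context
  fixes V s
  assumes fin: "finite V" and con: "conn V" and deg: "min_deg s V" and big: "2 * s + 2 \<le> card V"
    and nopath: "\<And>p. path_in V p \<Longrightarrow> length p \<noteq> 2 * s + 2" and s1: "1 \<le> s"
begin

text \<open>The positions of neighbours of the head, and the successors of positions of neighbours
  of the last vertex, are subsets of \<open>{1..2 * s}\<close> of size at least \<open>s\<close>.
  They are disjoint, since a common position closes a cycle on \<open>2 * s + 1\<close> vertices,
  which extends to a forbidden path; so they partition the range. If \<open>Suc a\<close> were of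
  the first kind and \<open>a\<close> of the second, the cycle missing \<open>p ! a\<close> would
  have length \<open>2 * s\<close>. Hence the first kind is an initial segment.\<close>

lemma end_nbrs:
  assumes p: "path_in V p" "length p = 2 * s + 1" and no: "\<And>c. cycle_in V c \<Longrightarrow> length c \<noteq> 2 * s"
  shows "nbrs V (hd p) = (\<lambda>a. p ! a) ` {1..s}"
proof -
  have ne: "p \<noteq> []" "distinct p" "set p \<subseteq> V" using p by (auto simp: path_in_def)
  have ends: "hd p \<in> V" "last p \<in> V" using ne hd_in_set last_in_set by blast+
  have hdN: "nbrs V (hd p) \<subseteq> set p"
  proof
    fix x assume "x \<in> nbrs V (hd p)"
    then have x: "x \<in> V" "adj x (hd p)" using adj_sym by (auto simp: nbrs_def)
    show "x \<in> set p"
    proof (rule ccontr)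
      assume "x \<notin> set p"
      then have "path_in V (x # p)" using x p by (auto simp: path_in_Cons)
      then show False using nopath[of "x # p"] p by simp
    qed
  qed
  have lastN: "nbrs V (last p) \<subseteq> set p"
  proof
    fix x assume "x \<in> nbrs V (last p)"
    then have x: "x \<in> V" "adj (last p) x" by (auto simp: nbrs_def)
    show "x \<in> set p"
    proof (rule ccontr)
      assume "x \<notin> set p"
      then have "path_in V (p @ [x])"
        using x p by (intro path_in_append) (auto simp: path_in_def)
      then show False using nopath[of "p @ [x]"] p by simp
    qed
  qed
  define A where "A = {a \<in> {1..<length p}. p ! a \<in> nbrs V (hd p)}"
  define B where "B = {a \<in> {1..<length p}. p ! (a - 1) \<in> nbrs V (last p)}"
  have "card A = card (nbrs V (hd p))" "card B = card (nbrs V (last p))"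
    unfolding A_def B_def
    using card_hd_nbr_indices[OF ne(2,1) hdN] card_shifted_indices[OF ne(2,1) lastN] by simp_all
  then have cAB: "s \<le> card A" "s \<le> card B"
    using deg ends by (auto simp: min_deg_def)
  have AB: "A \<subseteq> {1..2 * s}" "B \<subseteq> {1..2 * s}" using p by (auto simp: A_def B_def)
  have finAB: "finite A" "finite B" using AB finite_subset by blast+
  have cross: "cycle_in V (take a p @ rev (drop b p))"
    if "a \<in> B" "b \<in> A" "a \<le> b" for a b
    using that by (intro path_in_cross p) (auto simp: A_def B_def nbrs_def)
  have disj: "A \<inter> B = {}"
  proof (rule ccontr)
    assume "\<not> ?thesis"
    then obtain a where a: "a \<in> A" "a \<in> B" by blast
    have "length (take a p @ rev (drop a p)) = 2 * s + 1"
      using a AB p by auto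
    with cycle_in_extend[OF cross[OF a(2,1)] con _ fin] big obtain q
      where "path_in V q" "length q = 2 * s + 2" by auto
    then show False using nopath by blast
  qed
  have cU: "card (A \<union> B) = card A + card B" using disj finAB by (simp add: card_Un_disjoint)
  moreover have "card (A \<union> B) \<le> card {1..2 * s}" using AB by (intro card_mono) auto
  ultimately have cA: "card A = s" and "card (A \<union> B) = card {1..2 * s}" using cAB by simp_all
  then have un: "A \<union> B = {1..2 * s}" using AB by (intro card_subset_eq) auto
  have down: "a \<in> A" if "Suc a \<in> A" "1 \<le> a" for a
  proof (rule ccontr)
    assume "a \<notin> A"
    moreover have "a \<in> {1..2 * s}" using that AB(1) by auto
    ultimately have "a \<in> B" using un by blast
    then have "cycle_in V (take a p @ rev (drop (Suc a) p))" using cross that by simp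
    moreover have "length (take a p @ rev (drop (Suc a) p)) = 2 * s" using p that AB by auto
    ultimately show False using no by blast
  qed
  have "A \<noteq> {}" using cA s1 by auto
  define t where "t = Max A"
  have t: "t \<in> A" "A \<subseteq> {1..t}" using \<open>A \<noteq> {}\<close> finAB AB by (auto simp: t_def)
  have "{1..t} \<subseteq> A"
  proof
    fix i assume "i \<in> {1..t}"
    then have "i \<le> t" "1 \<le> i" by auto
    then show "i \<in> A"
      by (induction i rule: inc_induct) (use t down in auto)
  qed
  with t have "A = {1..t}" by auto
  with cA have A: "A = {1..s}" by simp
  have "nbrs V (hd p) = (\<lambda>a. p ! a) ` A"
  proof
    show "nbrs V (hd p) \<subseteq> (\<lambda>a. p ! a) ` A"
    proof
      fix x assume x: "x \<in> nbrs V (hd p)"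
      then obtain a where a: "a < length p" "p ! a = x" using hdN by (metis in_set_conv_nth subsetD)
      have "a \<noteq> 0" using a x ne(1) not_in_nbrs by (metis hd_conv_nth)
      with a x show "x \<in> (\<lambda>a. p ! a) ` A" by (auto simp: A_def)
    qed
  qed (auto simp: A_def)
  with A show ?thesis by simp
qed

text \<open>Without such a cycle, the first \<open>s\<close> vertices of a path on
  \<open>2 * s + 1\<close> vertices have neighbours only among themselves and at position
  \<open>s\<close>. They meet at most \<open>s * (s - 1) / 2 + s\<close> edges, fewer than the
  \<open>s * s\<close> demanded by \<open>touch\<close> once \<open>2 \<le> s\<close>.\<close>

lemma ex_cycle:
  assumes s2: "2 \<le> s" and touch: "\<And>X. X \<subseteq> V \<Longrightarrow> card X = s \<Longrightarrow> ecount (V - X) + s * s \<le> ecount V"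
  shows "\<exists>c. cycle_in V c \<and> length c = 2 * s"
proof (rule ccontr)
  assume "\<not> ?thesis"
  then have no: "\<And>c. cycle_in V c \<Longrightarrow> length c \<noteq> 2 * s" by blast
  have "V \<noteq> {}" using big by auto
  then obtain p where p: "path_in V p" "length p = 2 * s + 1"
    using long_path[OF fin con deg order_refl _ deg, of "2 * s + 1"] big by auto
  define X where "X = set (take s p)"
  have pd: "distinct p" "set p \<subseteq> V" "p \<noteq> []" using p by (auto simp: path_in_def)
  have X: "X \<subseteq> V" "card X = s"
    using pd p by (auto simp: X_def distinct_card dest: in_set_takeD)
  have N: "nbrs V v \<subseteq> insert (p ! s) X" if v: "v \<in> X" for v
  proof -
    obtain i where "i < length (take s p)" "take s p ! i = v"
      using v unfolding X_def by (metis in_set_conv_nth)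
    then have i: "i < s" "v = p ! i" by auto
    have "hd p = p ! 0" using pd by (simp add: hd_conv_nth)
    have "p ! Suc i \<in> nbrs V (hd p)"
      using end_nbrs[OF p no] i by auto
    then have a: "adj (hd p) (p ! Suc i)" by (simp add: nbrs_def)
    \<comment> \<open>Rotation: the head is adjacent to \<open>p ! Suc i\<close>, so reversing the
      first \<open>Suc i\<close> vertices brings \<open>v\<close> to the front and permutes only
      positions below \<open>s\<close>.\<close>
    define q where "q = rev (take (Suc i) p) @ drop (Suc i) p"
    have "path_in V q"
      unfolding q_def
    proof (rule path_in_append)
      show "set (rev (take (Suc i) p)) \<inter> set (drop (Suc i) p) = {}"
        using pd by (simp add: set_take_disj_set_drop_if_distinct)
      show "adj (last (rev (take (Suc i) p))) (hd (drop (Suc i) p))"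
        using a p i by (simp add: last_rev hd_drop_conv_nth)
    qed (use p i in \<open>auto simp: path_in_take path_in_drop\<close>)
    moreover have "length q = 2 * s + 1" using p i by (simp add: q_def)
    ultimately have "nbrs V (hd q) = (\<lambda>a. q ! a) ` {1..s}" using end_nbrs no by blast
    moreover have "hd q = v" using i p pd by (simp add: q_def hd_append hd_rev last_take)
    moreover have "q ! a \<in> insert (p ! s) X" if "a \<in> {1..s}" for a
    proof -
      have "\<exists>b\<le>s. q ! a = p ! b"
      proof (cases "a < Suc i")
        case True
        then have "q ! a = p ! (i - a)" using p i by (simp add: q_def nth_append rev_nth)
        then show ?thesis using i by (intro exI[of _ "i - a"]) auto
      next
        case False
        then have "q ! a = p ! a" using p i that by (simp add: q_def nth_append)
        then show ?thesis using that by auto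
      qed
      then obtain b where b: "b \<le> s" "q ! a = p ! b" by blast
      show ?thesis
      proof (cases "b = s")
        case False
        then have "take s p ! b = p ! b" "b < length (take s p)" using b p by auto
        then have "p ! b \<in> X" unfolding X_def by (metis nth_mem)
        then show ?thesis using b by simp
      qed (use b in simp)
    qed
    ultimately show ?thesis by (metis image_subsetI)
  qed
  have "card (nbrs (V - X) v) \<le> 1" if "v \<in> X" for v
  proof -
    have "nbrs (V - X) v \<subseteq> {p ! s}" using N[OF that] by (auto simp: nbrs_def)
    then show ?thesis using card_mono[of "{p ! s}"] by fastforce
  qed
  then have "(\<Sum>v\<in>X. card (nbrs (V - X) v)) \<le> (\<Sum>v\<in>X. 1)" by (intro sum_mono)
  then have "(\<Sum>v\<in>X. card (nbrs (V - X) v)) \<le> s" using X by simp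
  moreover have "ecount (X \<union> (V - X)) \<le> ecount X + ecount (V - X) + (\<Sum>v\<in>X. card (nbrs (V - X) v))"
    using fin X finite_subset by (intro ecount_Un_le) auto
  moreover have "X \<union> (V - X) = V" using X by auto
  moreover have "2 * ecount X \<le> s * (s - 1)" using ecount_le_pairs[of X] X by (simp add: X_def)
  ultimately have "2 * (s * s) \<le> s * (s - 1) + 2 * s" using touch[OF X] by simp
  also have "\<dots> = s * s + s" using s2 by (cases s) auto
  also have "\<dots> < 2 * (s * s)" using s2 by simp
  finally show False by simp
qed

text \<open>An edge between two outside vertices, one of them adjacent to the cycle, would continue
  around the cycle to a path on \<open>2 * s + 2\<close> vertices. By connectivity, every outside
  vertex is therefore adjacent to the cycle itself.\<close>

lemma outside_nbrs:
  assumes c: "cycle_in V c" "length c = 2 * s" and x: "x \<in> V - set c"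
  shows "nbrs V x \<subseteq> set c"
proof -
  have no: False if uw: "u \<in> V - set c" "w \<in> V - set c" "adj w u" "y \<in> set c" "adj u y" for u w y
  proof -
    obtain c' where "cycle_in V c'" "set c' = set c" "length c' = length c" "hd c' = y"
      using cycle_in_rotate_hd[OF c(1) uw(4)] by blast
    then have "path_in V (w # u # c')" "length (w # u # c') = 2 * s + 2"
      using uw c by (auto simp: path_in_Cons cycle_in_def)
    then show False using nopath by blast
  qed
  define D where "D = set c \<union> {u \<in> V. \<exists>y\<in>set c. adj u y}"
  have "D = V"
  proof (rule ccontr)
    assume "D \<noteq> V"
    moreover have "D \<subseteq> V" "D \<noteq> {}" using c by (auto simp: D_def cycle_in_def path_in_def)
    ultimately obtain u w where uw: "u \<in> D" "w \<in> V - D" "adj u w"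
      using conn_leaves[OF con] by metis
    then have "u \<notin> set c" using adj_sym by (auto simp: D_def)
    then show False using no[of u w] uw adj_sym by (auto simp: D_def)
  qed
  then obtain y where "y \<in> set c" "adj x y" using x by (auto simp: D_def)
  then show ?thesis using no[of x] x adj_sym by (auto simp: nbrs_def)
qed

text \<open>\<open>x\<close> has at least \<open>s\<close> neighbours, all on the cycle, and no two
  are consecutive: otherwise \<open>x\<close> could be inserted, and the cycle on
  \<open>2 * s + 1\<close> vertices extends to a forbidden path. On \<open>2 * s\<close> positions
  this leaves only every second one.\<close>

lemma outside_alternating:
  assumes c: "cycle_in V c" "length c = 2 * s" and x: "x \<in> V - set c" and a: "a < 2 * s"
  shows "adj x (c ! (Suc a mod (2 * s))) \<longleftrightarrow> \<not> adj x (c ! a)"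
proof -
  define I where "I = {a. a < 2 * s \<and> adj x (c ! a)}"
  define g where "g a = Suc a mod (2 * s)" for a
  have cd: "distinct c" "set c \<subseteq> V" "path_in V c" "c \<noteq> []" using c by (auto simp: cycle_in_def path_in_def)
  have "{a. a < length c \<and> c ! a \<in> nbrs V x} = I"
    using c cd by (auto simp: I_def nbrs_def)
  then have cI: "s \<le> card I"
    using card_nth_indices[OF cd(1) outside_nbrs[OF c x]] deg x by (auto simp: min_deg_def)
  have nc: "\<not> (b \<in> I \<and> g b \<in> I)" for b
  proof
    assume b: "b \<in> I \<and> g b \<in> I"
    define c' where "c' = rotate (Suc b) c"
    have c': "cycle_in V c'" "set c' = set c" "length c' = 2 * s"
      using cycle_in_rotate[OF c(1), of "Suc b"] c(2) unfolding c'_def by simp_all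
    have "hd c' = c ! g b" unfolding c'_def g_def using cd c by (subst hd_rotate_conv_nth) auto
    moreover have "last c' = hd (rotate b c)"
      unfolding c'_def using cd by (cases "rotate b c") auto
    then have "last c' = c ! b" using b cd c by (simp add: hd_rotate_conv_nth I_def)
    ultimately have "cycle_in V (x # c')"
      using c' b x adj_sym s1 by (auto simp: cycle_in_def path_in_Cons I_def)
    with cycle_in_extend[OF this con _ fin] big c' obtain q
      where "path_in V q" "length q = 2 * s + 2" by auto
    then show False using nopath by blast
  qed
  have inj: "inj_on g {..<2 * s}"
  proof (rule inj_onI)
    fix a b assume "a \<in> {..<2 * s}" "b \<in> {..<2 * s}" "g a = g b"
    then show "a = b" by (auto simp: g_def mod_Suc split: if_splits)
  qed
  have "I \<subseteq> {..<2 * s}" by (auto simp: I_def)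
  then have "card (g ` I) = card I" "finite I"
    using inj by (auto intro: card_image inj_on_subset finite_subset)
  moreover have "I \<inter> g ` I = {}" using nc by auto
  ultimately have "2 * s \<le> card (I \<union> g ` I)" using cI by (simp add: card_Un_disjoint)
  moreover have sub: "I \<union> g ` I \<subseteq> {..<2 * s}" using s1 by (auto simp: I_def g_def)
  ultimately have un: "I \<union> g ` I = {..<2 * s}"
    by (intro card_seteq) simp_all
  have "g a < 2 * s" using s1 by (simp add: g_def)
  have "g a \<in> I \<longleftrightarrow> a \<notin> I"
  proof
    assume "a \<notin> I"
    show "g a \<in> I"
    proof (rule ccontr)
      assume "g a \<notin> I"
      then obtain b where "b \<in> I" "g b = g a" using un \<open>g a < 2 * s\<close> by (metis UnE imageE lessThan_iff)
      then have "b = a" using inj a by (auto simp: I_def inj_on_def)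
      with \<open>b \<in> I\<close> \<open>a \<notin> I\<close> show False by simp
    qed
  qed (use nc in blast)
  then show ?thesis using a \<open>g a < 2 * s\<close> by (auto simp: I_def g_def)
qed

lemma nbrs_if_adj_hd:
  assumes c: "cycle_in V c" "length c = 2 * s" and x: "x \<in> V - set c" and hd: "adj x (hd c)"
  shows "nbrs V x = (\<lambda>a. c ! a) ` {a. a < 2 * s \<and> even a}"
proof -
  have "c \<noteq> []" using c by (auto simp: cycle_in_def path_in_def)
  have adj: "adj x (c ! a) \<longleftrightarrow> even a" if "a < 2 * s" for a
    using that
  proof (induction a)
    case 0
    then show ?case using hd \<open>c \<noteq> []\<close> by (simp add: hd_conv_nth)
  next
    case (Suc a)
    then show ?case using outside_alternating[OF c x, of a] by simp
  qed
  show ?thesis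
  proof
    show "nbrs V x \<subseteq> (\<lambda>a. c ! a) ` {a. a < 2 * s \<and> even a}"
    proof
      fix y assume y: "y \<in> nbrs V x"
      then have "y \<in> set c" using outside_nbrs[OF c x] by auto
      then obtain a where a: "a < 2 * s" "y = c ! a" using c by (metis in_set_conv_nth)
      with y adj show "y \<in> (\<lambda>a. c ! a) ` {a. a < 2 * s \<and> even a}" by (auto simp: nbrs_def)
    qed
    show "(\<lambda>a. c ! a) ` {a. a < 2 * s \<and> even a} \<subseteq> nbrs V x"
    proof
      fix y assume "y \<in> (\<lambda>a. c ! a) ` {a. a < 2 * s \<and> even a}"
      then obtain a where a: "a < 2 * s" "even a" "y = c ! a" by auto
      then have "y \<in> V" using c nth_mem[of a c] by (auto simp: cycle_in_def path_in_def)
      with a adj show "y \<in> nbrs V x" by (simp add: nbrs_def)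
    qed
  qed
qed

text \<open>Outside vertices attached to different parity classes would be the ends of a path
  running once around the cycle, with \<open>2 * s + 2\<close> vertices.\<close>

lemma nbrs_if_other_adj_hd:
  assumes c: "cycle_in V c" "length c = 2 * s" and x: "x \<in> V - set c" "adj x (hd c)" and y: "y \<in> V - set c"
  shows "nbrs V y = (\<lambda>a. c ! a) ` {a. a < 2 * s \<and> even a}"
proof (rule nbrs_if_adj_hd[OF c y], rule ccontr)
  assume n: "\<not> adj y (hd c)"
  obtain h r where hr: "c = h # r" using c by (cases c) (auto simp: cycle_in_def path_in_def)
  have "r \<noteq> []" using hr c s1 by auto
  have "adj y (c ! 1)"
    using outside_alternating[OF c y, of 0] n s1 hr by (cases s) auto
  then have yr: "adj y (hd r)" using hr \<open>r \<noteq> []\<close> by (simp add: hd_conv_nth)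
  have "path_in V r" using c hr \<open>r \<noteq> []\<close> by (simp add: cycle_in_def path_in_Cons)
  then have "path_in V (rev r @ [y])"
    using yr y hr \<open>r \<noteq> []\<close> adj_sym by (intro path_in_append) (auto simp: path_in_def last_rev)
  then have "path_in V (x # h # rev r @ [y])"
    using c x y n hr \<open>r \<noteq> []\<close> adj_sym
    by (auto simp: path_in_Cons cycle_in_def hd_rev hd_append)
  moreover have "length (x # h # rev r @ [y]) = 2 * s + 2" using c hr by simp
  ultimately show False using nopath by blast
qed

lemma extremal_if_cycle:
  assumes c0: "cycle_in V c0" "length c0 = 2 * s" and e: "2 * s * card V \<le> 2 * ecount V + s * (s + 1)"
  shows "extremal s V"
proof -
  have cc: "card (set c0) = 2 * s" "set c0 \<subseteq> V"
    using c0 by (auto simp: cycle_in_def path_in_def distinct_card)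
  then have "2 \<le> card (V - set c0)" using big fin by (simp add: card_Diff_subset)
  then obtain x where x: "x \<in> V - set c0" by (metis card.empty equals0I not_numeral_le_zero)
  have "nbrs V x \<noteq> {}" using deg x s1 by (auto simp: min_deg_def)
  then obtain h where h: "h \<in> set c0" "adj x h" using outside_nbrs[OF c0 x] by (auto simp: nbrs_def)
  obtain c where c: "cycle_in V c" "set c = set c0" "length c = 2 * s" "hd c = h"
    using cycle_in_rotate_hd[OF c0(1) h(1)] c0(2) by metis
  have cd: "distinct c" "c \<noteq> []" "successively adj c" "adj (last c) (hd c)" "set c \<subseteq> V"
    using c by (auto simp: cycle_in_def path_in_def)
  define S where "S = (\<lambda>a. c ! a) ` {a. a < 2 * s \<and> even a}"
  have xc: "x \<in> V - set c" "adj x (hd c)" using x c h by auto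
  have out: "nbrs V y = S" if "y \<in> V - set c" for y
    unfolding S_def by (rule nbrs_if_other_adj_hd[OF c(1,3) xc that])
  \<comment> \<open>A second outside vertex stays outside after the exchange below and fixes the
    parity class for the modified cycle.\<close>
  obtain y where y: "y \<in> V - set c" "y \<noteq> x"
  proof -
    have "\<not> V - set c \<subseteq> {x}"
      using \<open>2 \<le> card (V - set c0)\<close> card_mono[of "{x}" "V - set c0"] c(2) by auto
    then show ?thesis using that by auto
  qed
  have odd: "nbrs V (c ! b) = S" if b: "b < 2 * s" "odd b" for b
  proof -
    \<comment> \<open>Exchanging \<open>c ! b\<close>, with \<open>b\<close> odd, for
      \<open>x\<close> gives another cycle of the same length, since \<open>x\<close> is adjacent to
      all even positions. Now \<open>c ! b\<close> is an outside vertex, and its neighbourhood can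
      be read off this cycle.\<close>
    define d where "d = c[b := x]"
    have b0: "0 < b" using b by (auto intro: Nat.gr0I)
    have ld: "length d = 2 * s" "d \<noteq> []" using c cd by (auto simp: d_def)
    have hdd: "hd d = hd c" using b0 cd by (cases c; cases b) (auto simp: d_def)
    have xe: "adj x (c ! a)" if "a < 2 * s" "even a" for a
      using out[OF xc(1)] that unfolding S_def nbrs_def by blast
    have dn: "d ! a = (if a = b then x else c ! a)" if "a < 2 * s" for a
      using that c by (simp add: d_def nth_list_update)
    have sd: "set d = insert x (set c - {c ! b})"
      using b c cd by (simp add: d_def set_update_distinct)
    have "cycle_in V d"
      unfolding cycle_in_def path_in_def
    proof (intro conjI)
      show "distinct d" using cd xc by (simp add: d_def distinct_list_update)
      show "set d \<subseteq> V" using sd xc cd by auto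
      show "successively adj d"
        unfolding successively_conv_nth
      proof (intro allI impI)
        fix i assume i: "Suc i < length d"
        have "adj (c ! i) (c ! Suc i)" using successively_nth[OF cd(3)] i c(3) ld by simp
        then show "adj (d ! i) (d ! Suc i)"
          using i ld b dn[of i] dn[of "Suc i"] xe[of i] xe[of "Suc i"] adj_sym by auto
      qed
      have "last d = d ! (2 * s - 1)" "last c = c ! (2 * s - 1)" using ld c cd by (auto simp: last_conv_nth)
      then show "adj (last d) (hd d)"
        using dn[of "2 * s - 1"] s1 cd(4) xc(2) hdd by auto
    qed (use ld in auto)
    moreover have "adj y (hd d)"
    proof -
      have "hd c \<in> S" using cd s1 unfolding S_def by (auto simp: hd_conv_nth)
      then show ?thesis using out[OF y(1)] hdd by (auto simp: nbrs_def)
    qed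
    moreover have "y \<in> V - set d" "c ! b \<in> V - set d"
    proof -
      have "c ! b \<in> set c" using nth_mem[of b c] b c(3) by simp
      then show "y \<in> V - set d" "c ! b \<in> V - set d" using sd y xc cd by auto
    qed
    ultimately have "nbrs V (c ! b) = (\<lambda>a. d ! a) ` {a. a < 2 * s \<and> even a}"
      using nbrs_if_other_adj_hd ld by blast
    also have "\<dots> = S" unfolding S_def using b dn by (intro image_cong) auto
    finally show ?thesis .
  qed
  have all: "nbrs V v = S" if "v \<in> V - S" for v
  proof (cases "v \<in> set c")
    case True
    then obtain b where b: "b < 2 * s" "v = c ! b" using c(3) by (metis in_set_conv_nth)
    then have "odd b" using that by (auto simp: S_def)
    with b odd show ?thesis by simp
  next
    case False
    with that out show ?thesis by simp
  qed
  have "S \<subseteq> set c" using c(3) by (auto simp: S_def)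
  have cardS: "card S = s"
  proof -
    have "{a. a < 2 * s \<and> even a} = (\<lambda>i. 2 * i) ` {..<s}" by (auto elim!: evenE)
    then have "S = (\<lambda>i. c ! (2 * i)) ` {..<s}" by (auto simp: S_def image_image)
    moreover have "inj_on (\<lambda>i. c ! (2 * i)) {..<s}"
      using cd c(3) by (auto simp: inj_on_def nth_eq_iff_index_eq)
    ultimately show ?thesis by (simp add: card_image)
  qed
  show ?thesis
    using extremalI[OF fin, of S] all \<open>S \<subseteq> set c\<close> cd(5) e cardS by auto
qed

end

end

section \<open>Disjoint paths\<close>

text \<open>The left side without \<open>s * (s + 1)\<close> bounds twice the number of edges if the
  dense core has at most \<open>2 * s + 1\<close> vertices. As \<open>k\<close> is at least 2,
  \<open>s - c = l * (k - q)\<close> is at least a quarter of \<open>l * k\<close>, which makes the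
  gap of slopes worth a bound on \<open>n\<close> linear in \<open>l * k\<close>.\<close>

lemma small_core_arith:
  fixes l k q c s n :: nat
  assumes "2 \<le> l" "2 \<le> k" "s + 1 = l * k" "c + 1 = l * q" "2 * q \<le> k + 1" "5 * l * k + 3 \<le> n" "c \<le> s"
  shows "2 * c * n + 2 * (s - c) * (2 * s + 1) + s * (s + 1) < 2 * s * n"
proof -
  define L K Q S C N where "L = int l" and "K = int k" and "Q = int q" and "S = int s" and "C = int c" and "N = int n"
  note defs = L_def K_def Q_def S_def C_def N_def
  have "int (s + 1) = int (l * k)" "int (c + 1) = int (l * q)" "int (5 * l * k + 3) \<le> int n"
    using assms by (simp_all del: of_nat_mult of_nat_add)
  then have h: "2 \<le> L" "2 \<le> K" "S + 1 = L * K" "C + 1 = L * Q" "2 * Q \<le> K + 1" "5 * (L * K) + 3 \<le> N"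
    using assms by (simp_all add: defs algebra_simps)
  have nn: "0 \<le> C" "C \<le> S" "0 \<le> S" using assms by (simp_all add: defs)
  have d: "L * K \<le> 4 * (S - C)"
  proof -
    have "K \<le> 4 * (K - Q)" using h(2,5) by (simp add: algebra_simps)
    then have "L * K \<le> L * (4 * (K - Q))" using h by (intro mult_left_mono) auto
    also have "\<dots> = 4 * (S - C)" using h by (simp add: algebra_simps)
    finally show ?thesis .
  qed
  have "4 * (S * (S + 1)) < (L * K) * (4 * (L * K))"
    using h nn by (simp add: algebra_simps flip: h(3))
  also have "\<dots> \<le> (L * K) * (2 * N - 4 * S - 2)"
    using h nn by (intro mult_left_mono) linarith+
  also have "\<dots> \<le> (4 * (S - C)) * (2 * N - 4 * S - 2)"
    using d h nn by (intro mult_right_mono) linarith+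
  finally have "S * (S + 1) < 2 * (S - C) * (N - 2 * S - 1)" by (simp add: algebra_simps)
  then have "2 * C * N + 2 * (S - C) * (2 * S + 1) + S * (S + 1) < 2 * S * N"
    by (simp add: algebra_simps)
  then have "int (2 * c * n + 2 * (s - c) * (2 * s + 1) + s * (s + 1)) < int (2 * s * n)"
    by (simp only: defs of_nat_add of_nat_mult of_nat_diff[OF assms(7)] of_nat_numeral of_nat_1)
  then show ?thesis by (simp only: of_nat_less_iff)
qed

text \<open>Here \<open>u\<close> and \<open>w\<close> are the sizes of the dense core and of its core of minimum degree \<open>s - j + 1\<close>,
  and \<open>eV\<close>, \<open>eU\<close>, \<open>eW\<close> count the edges of the graph and of these two cores.\<close>

lemma core_arith:
  fixes s c n j u w eV eU eW :: nat
  assumes I1: "2 * c * n + 2 * (s - c) * (2 * s + 1) + s * (s + 1) < 2 * s * n"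
    and cs: "c \<le> s" and j: "1 \<le> j" "j \<le> s" and w: "w \<le> 2 * s + 1" "w \<le> u" and u: "2 * s + 2 \<le> u" "u \<le> n"
    and n: "5 * s + 8 \<le> n"
    and eV: "eV + c * u \<le> eU + c * n"
    and eU: "eU + (s - j) * w \<le> eW + (s - j) * u"
    and eW: "2 * eW + (s + j) * (s + j + 1) \<le> 2 * (s + j) * w"
  shows "2 * eV + s * (s + 1) < 2 * s * n"
proof -
  define S C N J U W x y z where "S = int s" and "C = int c" and "N = int n" and "J = int j" and "U = int u"
    and "W = int w" and "x = int eV" and "y = int eU" and "z = int eW"
  note defs = S_def C_def N_def J_def U_def W_def x_def y_def z_def
  have "int (2 * c * n + 2 * (s - c) * (2 * s + 1) + s * (s + 1)) < int (2 * s * n)"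
    "int (eV + c * u) \<le> int (eU + c * n)" "int (eU + (s - j) * w) \<le> int (eW + (s - j) * u)"
    "int (2 * eW + (s + j) * (s + j + 1)) \<le> int (2 * (s + j) * w)"
    using I1 eV eU eW by (simp_all only: of_nat_less_iff of_nat_le_iff)
  then have h: "2 * C * N + 2 * (S - C) * (2 * S + 1) + S * (S + 1) < 2 * S * N"
    "x + C * U \<le> y + C * N" "y + (S - J) * W \<le> z + (S - J) * U"
    "2 * z + (S + J) * (S + J + 1) \<le> 2 * (S + J) * W"
    by (simp_all only: of_nat_add of_nat_mult of_nat_diff[OF cs] of_nat_diff[OF j(2)] of_nat_numeral of_nat_1 flip: defs)
  have r: "0 \<le> C" "C \<le> S" "1 \<le> J" "J \<le> S" "0 \<le> W" "W \<le> 2 * S + 1" "2 * S + 2 \<le> U" "U \<le> N" "5 * S + 8 \<le> N"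
    using cs j w u n by (simp_all add: defs)
  have "2 * x \<le> 2 * C * (N - U) + 2 * (S - J) * U + 4 * (J * W) - (S + J) * (S + J + 1)"
    using h(2-4) by (simp add: algebra_simps)
  moreover have "J * W \<le> J * (2 * S + 1)" using r by (intro mult_left_mono) auto
  ultimately have x: "2 * x \<le> 2 * C * (N - U) + 2 * (S - J) * U + 4 * (J * (2 * S + 1)) - (S + J) * (S + J + 1)"
    by linarith
  have "2 * x + S * (S + 1) < 2 * S * N"
  \<comment> \<open>The bound on \<open>x\<close> has slope \<open>2 * (S - J - C)\<close> in
    \<open>U\<close>. If this is nonnegative, the worst case is \<open>U = N\<close>; otherwise
    \<open>U\<close> is lowered to \<open>2 * S + 1\<close>, where \<open>h(1)\<close>
    applies.\<close>
  proof (cases "C \<le> S - J")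
    case True
    then have "C * (N - U) \<le> (S - J) * (N - U)" using r by (intro mult_right_mono) auto
    with x have "2 * x \<le> 2 * (S - J) * N + 4 * (J * (2 * S + 1)) - (S + J) * (S + J + 1)"
      by (simp add: algebra_simps)
    moreover have "J * (6 * S + 3 - J) < J * (2 * N)"
      using r by (intro mult_strict_left_mono) linarith+
    ultimately show ?thesis by (simp add: algebra_simps)
  next
    case False
    have "0 \<le> (C - (S - J)) * (U - (2 * S + 1))" using False r by (intro mult_nonneg_nonneg) linarith+
    moreover have "0 \<le> (S - J) * (S - J + 1)" using r by (intro mult_nonneg_nonneg) linarith+
    ultimately show ?thesis using x h(1) by (simp add: algebra_simps)
  qed
  then have "int (2 * eV + s * (s + 1)) < int (2 * s * n)"
    by (simp only: defs of_nat_add of_nat_mult of_nat_numeral of_nat_1)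
  then show ?thesis by (simp only: of_nat_less_iff)
qed

section \<open>Packings by paths, and the forest without stars\<close>

context edge_set
begin

text \<open>A star, too, is a list of \<open>2 * l\<close> vertices, its centre first; disjointness
  of all pieces is distinctness of one concatenation.\<close>

definition packing :: "'a set \<Rightarrow> nat \<Rightarrow> 'a list list \<Rightarrow> 'a list list \<Rightarrow> bool" where
  "packing W l ps ss \<longleftrightarrow> (\<forall>p\<in>set ps. path_in W p \<and> length p = 2 * l)
     \<and> (\<forall>q\<in>set ss. set q \<subseteq> W \<and> length q = 2 * l \<and> (\<forall>u\<in>set (tl q). adj (hd q) u))
     \<and> distinct (concat ps @ concat ss)"

definition has_forest :: "'a set \<Rightarrow> nat \<Rightarrow> nat \<Rightarrow> nat \<Rightarrow> bool" where
  "has_forest W l k1 k2 \<longleftrightarrow> (\<exists>ps ss. length ps = k1 \<and> length ss = k2 \<and> packing W l ps ss)"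

lemma cut_path:
  assumes "path_in W p" "2 * l * j \<le> length p" "1 \<le> l"
  shows "\<exists>ps. length ps = j \<and> (\<forall>q\<in>set ps. path_in W q \<and> length q = 2 * l)
           \<and> distinct (concat ps) \<and> set (concat ps) \<subseteq> set p"
  using assms(1,2)
proof (induction j arbitrary: p)
  case 0
  then show ?case by (intro exI[of _ "[]"]) simp
next
  case (Suc j)
  define r where "r = drop (2 * l) p"
  define q where "q = take (2 * l) p"
  have lq: "2 * l \<le> length p" using Suc.prems(2) by simp
  have q: "path_in W q" "length q = 2 * l"
    using Suc.prems lq assms(3) by (auto simp: q_def path_in_take)
  have qr: "p = q @ r" "distinct p" using Suc.prems by (auto simp: q_def r_def path_in_def)
  show ?case
  \<comment> \<open>Only for \<open>j = 0\<close> can the remainder be empty, and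
    \<open>path_in\<close> excludes the empty list.\<close>
  proof (cases "j = 0")
    case True
    then show ?thesis using q qr by (intro exI[of _ "[q]"]) auto
  next
    case False
    have "2 * l * j \<le> length r" using Suc.prems(2) by (simp add: r_def)
    moreover have "0 < 2 * l * j" using False assms(3) by simp
    ultimately have "0 < length r" by linarith
    then have "2 * l < length p" by (simp add: r_def)
    then have "path_in W r"
      unfolding r_def by (rule path_in_drop[OF Suc.prems(1)])
    from Suc.IH[OF this \<open>2 * l * j \<le> length r\<close>] obtain ps where
      "length ps = j" "\<forall>q\<in>set ps. path_in W q \<and> length q = 2 * l" "distinct (concat ps)" "set (concat ps) \<subseteq> set r"
      by blast
    with q qr show ?thesis by (intro exI[of _ "q # ps"]) auto
  qed
qed

lemma has_forest_if_paths:
  assumes "path_in X p" "path_in Y q" "X \<inter> Y = {}" "X \<union> Y \<subseteq> W" "1 \<le> l"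
    and "2 * l * j \<le> length p" "2 * l * i \<le> length q" "k \<le> j + i"
  shows "has_forest W l k 0"
proof -
  obtain ps where ps: "length ps = j" "\<forall>q\<in>set ps. path_in X q \<and> length q = 2 * l"
    "distinct (concat ps)" "set (concat ps) \<subseteq> set p"
    using cut_path[OF assms(1,6,5)] by blast
  obtain qs where qs: "length qs = i" "\<forall>q\<in>set qs. path_in Y q \<and> length q = 2 * l"
    "distinct (concat qs)" "set (concat qs) \<subseteq> set q"
    using cut_path[OF assms(2,7,5)] by blast
  have "set p \<subseteq> X" "set q \<subseteq> Y" using assms by (auto simp: path_in_def)
  then have "set (concat ps) \<inter> set (concat qs) = {}" using ps(4) qs(4) assms(3) by blast
  then have d: "distinct (concat (ps @ qs))" using ps(3) qs(3) by (simp only: concat_append distinct_append)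
  define rs where "rs = take k (ps @ qs)"
  have "concat (ps @ qs) = concat rs @ concat (drop k (ps @ qs))"
    by (metis append_take_drop_id concat_append rs_def)
  with d have "distinct (concat rs)" by (simp only: distinct_append)
  moreover have "length rs = k" using ps qs assms(8) by (simp add: rs_def)
  moreover have "path_in W r \<and> length r = 2 * l" if "r \<in> set rs" for r
  proof -
    have "r \<in> set ps \<union> set qs" using that unfolding rs_def by (metis in_set_takeD set_append)
    then show ?thesis using ps qs assms(4) path_in_mono[of X r W] path_in_mono[of Y r W] by auto
  qed
  ultimately show ?thesis unfolding has_forest_def packing_def by (intro exI[of _ rs] exI[of _ "[]"]) simp
qed

text \<open>One side of the split meets \<open>T\<close> and keeps minimum degree \<open>r\<close>
  there, the other side keeps \<open>t\<close>; they are disjoint, and connectedness of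
  \<open>U\<close> joins them.\<close>

lemma path_if_two_cores:
  assumes con: "conn U" and fin: "finite U" and W: "W \<subseteq> U" "min_deg t W" "\<not> conn W"
    and T: "T \<subseteq> W" "T \<noteq> {}" "min_deg r T"
  obtains p where "path_in U p" "r + t + 2 \<le> length p"
proof -
  obtain A B where AB: "A \<noteq> {}" "B \<noteq> {}" "A \<union> B = W" "A \<inter> B = {}"
    "\<And>x y. x \<in> A \<Longrightarrow> y \<in> B \<Longrightarrow> \<not> adj x y"
    using not_conn_split[OF W(3)] by blast
  have *: "\<exists>p. path_in U p \<and> r + t + 2 \<le> length p"
    if A: "A \<union> B = W" "A \<inter> B = {}" "B \<noteq> {}" "\<And>x y. x \<in> A \<Longrightarrow> y \<in> B \<Longrightarrow> \<not> adj x y" "T \<inter> A \<noteq> {}" for A B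
  proof -
    have "nbrs (T \<inter> A) v = nbrs T v" if "v \<in> T \<inter> A" for v
      using that A T by (auto simp: nbrs_def)
    then have rT: "min_deg r (T \<inter> A)" using T by (auto simp: min_deg_def)
    have "nbrs B v = nbrs W v" if v: "v \<in> B" for v
    proof -
      have "\<not> adj v u" if "u \<in> A" for u using A(4)[OF that v] adj_sym by blast
      then show ?thesis using A(1) by (auto simp: nbrs_def)
    qed
    then have tB: "min_deg t B" using W A by (auto simp: min_deg_def)
    have "T \<inter> A \<subseteq> U" "B \<subseteq> U" "(T \<inter> A) \<inter> B = {}" using A(1,2) W(1) by auto
    from join_paths[OF con fin this(1,2) A(5,3) this(3) rT tB] show ?thesis by metis
  qed
  have "\<exists>p. path_in U p \<and> r + t + 2 \<le> length p"
  proof (cases "T \<inter> A = {}")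
    case True
    then have "T \<inter> B \<noteq> {}" using T AB by blast
    then show ?thesis using *[of B A] AB adj_sym by (metis Int_commute Un_commute)
  next
    case False
    then show ?thesis using *[of A B] AB by blast
  qed
  then show ?thesis using that by blast
qed

theorem extremal_path_forest:
  fixes V :: "'a set"
  assumes fin: "finite V" and k: "2 \<le> k" and l: "2 \<le> l" and n: "5 * l * k + 3 \<le> card V"
    and free: "\<not> has_forest V l k 0" and s: "s + 1 = l * k"
    and e: "2 * s * card V \<le> 2 * ecount V + s * (s + 1)"
  shows "extremal s V"
proof -
  define n where "n = card V"
  \<comment> \<open>Half of \<open>k\<close> rounded up: two disjoint paths on
    \<open>2 * c + 2 = 2 * l * q\<close> vertices can be cut into at least \<open>k\<close>
    pieces.\<close>
  define q where "q = (k + 1) div 2"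
  define c where "c = l * q - 1"
  have q: "2 * q \<le> k + 1" "k \<le> 2 * q" "1 \<le> q" "q < k" using k by (auto simp: q_def)
  have "1 \<le> l * q" using q l by (simp add: Suc_le_eq)
  then have c: "c + 1 = l * q" by (simp add: c_def)
  have "l * q < l * k" using q l by simp
  then have cs: "c < s" using c s by linarith
  have I1: "2 * c * n + 2 * (s - c) * (2 * s + 1) + s * (s + 1) < 2 * s * n"
    using small_core_arith[OF l k s c q(1)] n cs unfolding n_def by simp
  have n5: "5 * s + 8 \<le> n" using assms(4) s unfolding n_def by simp
  have s3: "3 \<le> s" using s mult_le_mono[OF l k] by simp
  have nopath: "length p < 2 * s + 2" if p: "path_in V p" for p
  proof (rule ccontr)
    assume "\<not> ?thesis"
    then have "2 * l * k \<le> length p" using s by (simp add: algebra_simps)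
    then obtain ps where "length ps = k" "\<forall>q\<in>set ps. path_in V q \<and> length q = 2 * l" "distinct (concat ps)"
      using cut_path[OF p, of l k] l by auto
    then have "has_forest V l k 0"
      unfolding has_forest_def packing_def by (intro exI[of _ ps] exI[of _ "[]"]) simp
    then show False using free by simp
  qed
  obtain U where U: "U \<subseteq> V" "dense_core c U" "ecount V + c * card U \<le> ecount U + c * n"
    using ex_dense_core[OF fin, of c] unfolding n_def by blast
  have finU: "finite U" using U fin finite_subset by blast
  define u where "u = card U"
  have un: "u \<le> n" using U fin by (simp add: u_def n_def card_mono)
  have e': "2 * s * n \<le> 2 * ecount V + s * (s + 1)" using e by (simp add: n_def)
  have u: "2 * s + 2 \<le> u"
  proof (rule ccontr)
    assume "\<not> ?thesis"
    then have "u \<le> 2 * s + 1" by simp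
    have "2 * ecount U \<le> u * (u - 1)" using ecount_le_pairs[OF finU] by (simp add: u_def)
    also have "\<dots> \<le> u * (2 * s)" using \<open>u \<le> 2 * s + 1\<close> by (intro mult_left_mono) auto
    finally have "2 * ecount V + 2 * (c * u) \<le> 2 * (s * u) + 2 * (c * n)" using U(3) by (simp add: u_def algebra_simps)
    moreover have "s * u = c * u + (s - c) * u" using cs by (simp add: diff_mult_distrib)
    moreover have "(s - c) * u \<le> (s - c) * (2 * s + 1)" using \<open>u \<le> 2 * s + 1\<close> by (intro mult_left_mono) auto
    ultimately have "2 * ecount V \<le> 2 * c * n + 2 * (s - c) * (2 * s + 1)" by simp
    then show False using I1 e' by simp
  qed
  then have Une: "U \<noteq> {}" by (auto simp: u_def)
  have conU: "conn U"
  proof (rule ccontr)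
    assume "\<not> conn U"
    then obtain X Y where XY: "X \<union> Y = U" "X \<inter> Y = {}" "X \<noteq> {}" "Y \<noteq> {}" "dense_core c X" "dense_core c Y"
      using dense_core_split U(2) finU by metis
    have "finite X" "finite Y" using XY(1) finU by auto
    then obtain p p' where "path_in X p" "length p = 2 * c + 2" "path_in Y p'" "length p' = 2 * c + 2"
      using dense_core_path XY by metis
    moreover have "2 * c + 2 = 2 * l * q" using c by simp
    ultimately have "has_forest V l k 0"
      using has_forest_if_paths[of X p Y p' V l q q k] XY U l q by auto
    then show False using free by simp
  qed
  show ?thesis
  proof (cases "\<exists>X\<subseteq>U. X \<noteq> {} \<and> min_deg (Suc s) X")
    case False
    then have "2 * ecount U + s * (s + 1) \<le> 2 * s * u"
      unfolding u_def using u by (intro ecount_degenerate finU) (auto simp: u_def)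
    \<comment> \<open>The \<open>r\<close> vertices outside \<open>U\<close> contribute at most
      \<open>c\<close> edges each against the slope \<open>s > c\<close>, so the assumed number of
      edges forces \<open>r = 0\<close>.\<close>
    moreover obtain r where r: "n = u + r" using un le_Suc_ex by blast
    ultimately have "2 * ecount V + s * (s + 1) \<le> 2 * s * u + 2 * (c * r)"
      using U(3) by (simp add: u_def[symmetric] algebra_simps)
    moreover have "2 * s * n = 2 * s * u + 2 * (s * r)" by (simp add: r algebra_simps)
    ultimately have "s * r \<le> c * r" using e' by linarith
    then have "r = 0" using cs by simp
    then have UV: "U = V" using r card_subset_eq[OF fin U(1)] by (simp add: u_def n_def)
    \<comment> \<open>Since degeneracy bounds the edges of \<open>V - X\<close>, every such
      \<open>X\<close> meets at least \<open>s * card X\<close> edges. Sizes 1 and \<open>s\<close>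
      are used.\<close>
    have sub: "2 * ecount (V - X) + s * (s + 1) \<le> 2 * s * (n - card X)" if X: "X \<subseteq> V" "card X \<le> s" for X
    proof -
      have cX: "card (V - X) = n - card X" using X(1) finite_subset[OF X(1) fin] by (simp add: n_def card_Diff_subset)
      have "2 * ecount (V - X) + s * (s + 1) \<le> 2 * s * card (V - X)"
      proof (rule ecount_degenerate)
        show "s \<le> card (V - X)" using cX X n5 by linarith
        show "\<not> min_deg (Suc s) Z" if "Z \<subseteq> V - X" "Z \<noteq> {}" for Z using that False UV by blast
      qed (use fin in simp)
      then show ?thesis by (simp add: cX)
    qed
    have degV: "min_deg s V"
      unfolding min_deg_def
    proof
      fix v assume v: "v \<in> V"
      have "2 * ecount (V - {v}) + s * (s + 1) \<le> 2 * s * (n - 1)"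
        using sub[of "{v}"] v s3 by simp
      moreover have "2 * s * n = 2 * s * (n - 1) + 2 * s" using n5 by (cases n) auto
      ultimately show "s \<le> card (nbrs V v)"
        using e' ecount_remove[OF fin v] by linarith
    qed
    have touch: "ecount (V - X) + s * s \<le> ecount V" if X: "X \<subseteq> V" "card X = s" for X
    proof -
      have "2 * ecount (V - X) + s * (s + 1) \<le> 2 * s * (n - s)" using sub[of X] X by simp
      moreover have "2 * s * n = 2 * s * (n - s) + 2 * (s * s)"
        using n5 by (simp add: diff_mult_distrib2)
      ultimately show ?thesis using e' by linarith
    qed
    have np: "length p \<noteq> 2 * s + 2" if "path_in V p" for p using nopath[OF that] by simp
    have conV: "conn V" and big: "2 * s + 2 \<le> card V" and s1: "1 \<le> s" "2 \<le> s"
      using conU UV u s3 by (auto simp: u_def)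
    obtain cy where "cycle_in V cy" "length cy = 2 * s"
      using ex_cycle[OF fin conV degV big np s1 touch] by blast
    then show ?thesis using extremal_if_cycle[OF fin conV degV big np s1(1) _ _ e] by blast
  next
    case True
    define Q where "Q t \<longleftrightarrow> (\<exists>X\<subseteq>U. X \<noteq> {} \<and> min_deg t X)" for t
    have bound: "t \<le> 2 * s" if Qt: "Q t" for t
    proof (rule ccontr)
      assume "\<not> t \<le> 2 * s"
      then have t: "2 * s + 1 \<le> t" by simp
      obtain X where X: "X \<subseteq> U" "X \<noteq> {}" "min_deg t X" using Qt unfolding Q_def by blast
      then obtain x where "x \<in> X" by blast
      have "finite X" using X finU finite_subset by blast
      then obtain p where p: "path_in X p" "length p = Suc t"
        using greedy_path[OF _ X(3) \<open>x \<in> X\<close>] by blast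
      have "path_in V p" using path_in_mono[OF p(1), of V] X(1) U(1) by blast
      then show False using nopath p(2) t by fastforce
    qed
    have "Q (Suc s)" using True by (auto simp: Q_def)
    then obtain t where t: "Q t" "\<And>t'. Q t' \<Longrightarrow> t' \<le> t"
      using ex_has_greatest_nat[of Q "Suc s" id "Suc (2 * s)"] bound by fastforce
    have ts: "Suc s \<le> t" "t \<le> 2 * s" using t bound \<open>Q (Suc s)\<close> by auto
    define j where "j = t - s"
    have j: "1 \<le> j" "j \<le> s" "t = s + j" using ts by (auto simp: j_def)
    obtain T where T: "T \<subseteq> U" "T \<noteq> {}" "min_deg t T" using t unfolding Q_def by blast
    \<comment> \<open>\<open>Suc (s - j)\<close> is \<open>2 * s + 1 - t\<close>. Together with
      \<open>t\<close> it yields a path on at least \<open>2 * s + 3\<close> vertices if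
      \<open>W\<close> is disconnected, and one on \<open>2 * s + 2\<close> vertices if
      \<open>W\<close> is connected and has that many.\<close>
    have "min_deg (Suc (s - j)) T"
      using T(3) j unfolding min_deg_def by fastforce
    from ex_core[OF finU T(1) this] obtain W where W: "T \<subseteq> W" "W \<subseteq> U" "min_deg (Suc (s - j)) W"
      "ecount U + (s - j) * card W \<le> ecount W + (s - j) * u"
      unfolding u_def by blast
    have finW: "finite W" using W finU finite_subset by blast
    have "conn W"
    proof (rule ccontr)
      assume "\<not> conn W"
      then obtain p where p: "path_in U p" "t + Suc (s - j) + 2 \<le> length p"
        using path_if_two_cores[OF conU finU W(2,3) _ W(1) T(2,3)] by blast
      have "path_in V p" using path_in_mono[OF p(1), of V] U(1) by blast
      then show False using nopath p(2) j by fastforce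
    qed
    have w: "card W \<le> 2 * s + 1"
    proof (rule ccontr)
      assume "\<not> ?thesis"
      then have "2 * s + 2 \<le> card W" "2 * s + 2 \<le> Suc (s - j) + t + 1" using j by auto
      then obtain p where p: "path_in W p" "length p = 2 * s + 2"
        using long_path[OF finW \<open>conn W\<close> W(3,1) T(2,3), of "2 * s + 2"] by auto
      have "path_in V p" using path_in_mono[OF p(1), of V] W(2) U(1) by blast
      then show False using nopath p(2) by fastforce
    qed
    obtain x where "x \<in> T" using T by blast
    have "t \<le> card (nbrs T x)" using T \<open>x \<in> T\<close> by (auto simp: min_deg_def)
    also have "\<dots> \<le> card W" using W finW nbrs_subset[of T x] by (intro card_mono) auto
    finally have "t \<le> card W" .
    moreover have "\<not> min_deg (Suc t) X" if "X \<subseteq> W" "X \<noteq> {}" for X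
      using t(2)[of "Suc t"] that W(2) unfolding Q_def by (metis Suc_n_not_le_n order_trans)
    ultimately have "2 * ecount W + t * (t + 1) \<le> 2 * t * card W"
      using ecount_degenerate finW by blast
    then have eW: "2 * ecount W + (s + j) * (s + j + 1) \<le> 2 * (s + j) * card W" using j by simp
    have "card W \<le> u" using W finU by (simp add: u_def card_mono)
    from core_arith[OF I1 _ j(1,2) w this u un n5 _ W(4) eW, of "ecount V"] U(3) cs e'
    show ?thesis by (simp add: u_def)
  qed
qed

end

section \<open>Adding the stars\<close>

text \<open>The hypothesis is the bound on \<open>n\<close> with its negative terms moved to the
  other side. The coefficient of \<open>k1\<close> rests on
  \<open>5 * l + 4 \<le> 2 * l * l + 3 * l\<close>, an equality at \<open>l = 2\<close>.\<close>

lemma bound_linear: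
  fixes l k1 k2 n :: nat
  assumes l: "2 \<le> l"
    and n: "(2 * l * l + 3 * l) * k1 + (4 * l * l + 1) * k2 + 3 \<le> n + 4 * k1 + 2 * l * k2"
  shows "5 * l * k1 + k2 + 3 \<le> n"
proof -
  obtain a where a: "l = a + 2" using l by (metis le_add_diff_inverse2)
  have "5 * l + 4 \<le> 2 * l * l + 3 * l" "2 * l + 1 \<le> 4 * l * l + 1"
    by (simp_all add: a algebra_simps)
  then have "(5 * l + 4) * k1 \<le> (2 * l * l + 3 * l) * k1" "(2 * l + 1) * k2 \<le> (4 * l * l + 1) * k2"
    by (simp_all only: mult_right_mono)
  moreover have "(5 * l + 4) * k1 = 5 * l * k1 + 4 * k1" "(2 * l + 1) * k2 = 2 * l * k2 + k2"
    by (simp_all add: algebra_simps)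
  ultimately show ?thesis using n by linarith
qed

text \<open>With \<open>d + 1\<close> stars to place and maximum degree \<open>D\<close>, the
  summands before \<open>s * (s + 1)\<close> bound twice the number of edges outside a packing, at
  its path vertices, inside its stars, and from its stars to the outside. Writing
  \<open>l = a + 2\<close>, \<open>k1 = b + 2\<close> and \<open>n\<close> as its lower bound plus
  \<open>r\<close> turns the claim into an inequality of polynomials over the natural
  numbers.\<close>

lemma star_arith:
  fixes l k1 d n s D :: nat
  assumes l: "2 \<le> l" and k1: "2 \<le> k1"
    and n: "(2 * l * l + 3 * l) * k1 + (4 * l * l + 1) * (d + 1) + 3 \<le> n + 4 * k1 + 2 * l * (d + 1)"
    and s: "s = l * k1 + d" and D: "D + 2 = 2 * l * (k1 + d + 1)"
  shows "s + 2 \<le> n" "2 * ((l - 1) * n) + 4 * l * k1 * D + 2 * l * d * (2 * l * d - 1)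
      + 2 * (d * (D + (2 * l - 1) * (4 * l - 3))) + s * (s + 1) < 2 * s * n"
proof -
  obtain a b where ab: "l = a + 2" "k1 = b + 2"
    using l k1 by (metis le_add_diff_inverse2)
  have D': "D = 2 * a * b + 2 * a * d + 6 * a + 4 * b + 4 * d + 10"
    using D by (simp add: ab algebra_simps)
  obtain r where r: "n + 4 * k1 + 2 * l * (d + 1) = (2 * l * l + 3 * l) * k1 + (4 * l * l + 1) * (d + 1) + 3 + r"
    using n le_Suc_ex by blast
  have n': "n = 2 * a * a * b + 8 * a * a + 4 * a * a * d + 11 * a * b + 36 * a + 14 * a * d + 10 * b + 13 * d + 36 + r"
    using r by (simp add: ab algebra_simps)
  have X: "2 * l * d * (2 * l * d - 1) + 2 * l * d = 2 * l * d * (2 * l * d)"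
    by (cases "2 * l * d") auto
  have "2 * ((a + 1) * n) + 4 * l * k1 * D + 2 * l * d * (2 * l * d)
      + 2 * (d * (D + (2 * a + 3) * (4 * a + 5))) + s * (s + 1) < 2 * s * n + 2 * l * d"
    unfolding s D' n' ab by (simp add: algebra_simps)
  moreover have eqs: "l - 1 = a + 1" "2 * l - 1 = 2 * a + 3" "4 * l - 3 = 4 * a + 5"
    by (simp_all add: ab)
  ultimately show "2 * ((l - 1) * n) + 4 * l * k1 * D + 2 * l * d * (2 * l * d - 1)
      + 2 * (d * (D + (2 * l - 1) * (4 * l - 3))) + s * (s + 1) < 2 * s * n"
    using X unfolding eqs by linarith
  show "s + 2 \<le> n"
    unfolding s n' ab by (simp add: algebra_simps)
qed

section \<open>Enlarging packings by stars\<close>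

context edge_set
begin

lemma packing_subset:
  assumes "packing W l ps ss"
  shows "set (concat ps) \<subseteq> W" "set (concat ss) \<subseteq> W"
  using assms unfolding packing_def path_in_def set_concat by blast+

lemma card_concat:
  assumes "distinct (concat ps)" "\<forall>p\<in>set ps. length p = m"
  shows "card (set (concat ps)) = length ps * m"
proof -
  have "length (concat ps) = length ps * m"
    using assms(2) by (induction ps) auto
  then show ?thesis using distinct_card[OF assms(1)] by simp
qed

lemma packing_cards:
  assumes "packing W l ps ss"
  shows "card (set (concat ps)) = length ps * (2 * l)" "card (set (concat ss)) = length ss * (2 * l)"
  using assms card_concat[of ps "2 * l"] card_concat[of ss "2 * l"]
  by (simp_all only: packing_def distinct_append) blast+

lemma ex_star:
  assumes N: "N \<subseteq> nbrs W v" "finite N" "2 * l - 1 \<le> card N" and l: "1 \<le> l"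
  shows "\<exists>ys. set (v # ys) \<subseteq> insert v N \<and> length (v # ys) = 2 * l \<and> distinct (v # ys) \<and> (\<forall>u\<in>set ys. adj v u)"
proof -
  obtain L where L: "L \<subseteq> N" "card L = 2 * l - 1" "finite L"
    using obtain_subset_with_card_n[OF N(3)] N(2) finite_subset by metis
  obtain ys where ys: "set ys = L" "distinct ys" using finite_distinct_list[OF L(3)] by blast
  have "length ys = 2 * l - 1" using ys L distinct_card by metis
  then have "length (v # ys) = 2 * l" using l by simp
  moreover have "L \<subseteq> nbrs W v" using L N by blast
  then have "v \<notin> set ys" "\<forall>u\<in>set ys. adj v u" using ys by (auto simp: nbrs_def)
  ultimately show ?thesis using ys L by (intro exI[of _ ys]) auto
qed

lemma packing_add_star:
  assumes p: "packing W l ps ss" and W: "W \<subseteq> V" "finite V" and v: "v \<in> V" and l: "1 \<le> l"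
    and Z: "Z = set (concat ps) \<union> set (concat ss)" and vZ: "v \<notin> Z"
    and N: "2 * l - 1 \<le> card (nbrs V v - Z)"
  shows "has_forest V l (length ps) (Suc (length ss))"
proof -
  obtain ys where ys: "set (v # ys) \<subseteq> insert v (nbrs V v - Z)" "length (v # ys) = 2 * l"
    "distinct (v # ys)" "\<forall>u\<in>set ys. adj v u"
    using ex_star[OF Diff_subset _ N l] W(2) by auto
  have "set (v # ys) \<subseteq> V" using ys(1) v nbrs_subset[of V v] by blast
  moreover have "path_in V p" if "path_in W p" for p using that W path_in_mono by blast
  moreover have "set (v # ys) \<inter> Z = {}" using ys(1) vZ by auto
  then have "distinct (concat ps @ concat ((v # ys) # ss))"
    using p ys(3) unfolding packing_def Z by auto
  ultimately have "packing V l ps ((v # ys) # ss)"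
    using p ys(2,4) W(1) unfolding packing_def by (simp del: set_concat) blast
  then show ?thesis
    unfolding has_forest_def by (intro exI[of _ ps] exI[of _ "(v # ys) # ss"]) simp
qed

lemma packing_split_star:
  assumes p: "packing V l ps ss" and V: "finite V" and l: "1 \<le> l"
    and O: "O' \<subseteq> V" "O' \<inter> (set (concat ps) \<union> set (concat ss)) = {}"
    and q: "q \<in> set ss" and xy: "x \<in> set q" "y \<in> set q" "x \<noteq> y"
    and N: "4 * l - 2 \<le> card (nbrs O' x)" "4 * l - 2 \<le> card (nbrs O' y)"
  shows "has_forest V l (length ps) (Suc (length ss))"
proof -
  have finO: "finite O'" using O V finite_subset by blast
  have "2 * l - 1 \<le> card (nbrs O' x)" using N(1) l by linarith
  then obtain xs where xs: "set (x # xs) \<subseteq> insert x (nbrs O' x)" "length (x # xs) = 2 * l"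
    "distinct (x # xs)" "\<forall>u\<in>set xs. adj x u"
    using ex_star[OF order_refl _ _ l, of O' x] finO by auto
  have "length xs = 2 * l - 1" using xs(2) by simp
  then have "card (set xs) = 2 * l - 1" using xs(3) by (simp add: distinct_card)
  then have "2 * l - 1 \<le> card (nbrs O' y - set xs)"
    using diff_card_le_card_Diff[of "set xs" "nbrs O' y"] N(2) l by simp
  then obtain ys where ys: "set (y # ys) \<subseteq> insert y (nbrs O' y - set xs)" "length (y # ys) = 2 * l"
    "distinct (y # ys)" "\<forall>u\<in>set ys. adj y u"
    using ex_star[OF Diff_subset _ _ l, of O' y "set xs"] finO by auto
  have sO: "set xs \<subseteq> O'" "set ys \<subseteq> O'" "set ys \<inter> set xs = {}"
    using xs ys nbrs_subset[of O' x] nbrs_subset[of O' y] by auto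
  obtain s1 s2 where s12: "ss = s1 @ q # s2" using q by (meson split_list)
  have xyV: "x \<in> V" "y \<in> V" using p q xy unfolding packing_def by blast+
  have xyo: "x \<notin> O'" "y \<notin> O'" using O(2) q xy by auto
  have d: "distinct (concat ps @ concat s1 @ q @ concat s2)"
    using p s12 by (simp add: packing_def)
  have sub: "set (concat ps) \<inter> O' = {}" "set (concat s1) \<inter> O' = {}" "set (concat s2) \<inter> O' = {}"
    using O(2) s12 by auto
  have "distinct (concat ps @ concat ((x # xs) # (y # ys) # s1 @ s2))"
    using d sO sub xs(3) ys(3) xy xyo by (auto simp del: set_concat)
  then have "packing V l ps ((x # xs) # (y # ys) # s1 @ s2)"
    using p s12 xs(2,4) ys(2,4) sO O(1) xyV unfolding packing_def by auto
  then show ?thesis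
    unfolding has_forest_def s12
    by (intro exI[of _ ps] exI[of _ "(x # xs) # (y # ys) # s1 @ s2"]) simp
qed

lemma sum_concat_le:
  fixes f :: "'a \<Rightarrow> nat"
  assumes "\<forall>q\<in>set ss. sum f (set q) \<le> M"
  shows "sum f (set (concat ss)) \<le> length ss * M"
  using assms
proof (induction ss)
  case (Cons q ss)
  have "sum f (set q \<union> set (concat ss)) \<le> sum f (set q) + sum f (set (concat ss))"
    by (simp add: sum_Un_nat)
  with Cons show ?case by simp
qed simp

lemma double_choose_two: "2 * (n choose 2) = n * (n - 1)"
  by (induction n) (auto simp: numeral_2_eq_2 algebra_simps diff_mult_distrib2)

text \<open>The edges are the pairs in \<open>V\<close> that are not contained in
  \<open>V - S\<close>.\<close>

lemma ecount_extremal: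
  assumes "extremal s V" "finite V"
  shows "2 * ecount V + s * (s + 1) = 2 * s * card V"
proof -
  obtain S where S: "S \<subseteq> V" "card S = s" "induced V = {e. e \<subseteq> V \<and> card e = 2 \<and> e \<inter> S \<noteq> {}}"
    using assms(1) by (auto simp: extremal_def)
  have finS: "finite S" using S assms finite_subset by blast
  obtain r where r: "card V = s + r" "card (V - S) = r"
    using S assms(2) finS by (metis card_Diff_subset card_mono le_add_diff_inverse)
  have "induced V = {e. e \<subseteq> V \<and> card e = 2} - {e. e \<subseteq> V - S \<and> card e = 2}"
    using S(3) by auto
  moreover have "{e. e \<subseteq> V - S \<and> card e = 2} \<subseteq> {e. e \<subseteq> V \<and> card e = 2}" by auto
  moreover have "finite {e. e \<subseteq> V - S \<and> card e = 2}" using assms by simp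
  ultimately have "ecount V = (card V choose 2) - (card (V - S) choose 2)"
    using assms by (simp add: ecount_def card_Diff_subset n_subsets)
  then have "2 * ecount V = 2 * ((s + r) choose 2) - 2 * (r choose 2)"
    by (simp add: r)
  then have "2 * ecount V = (s + r) * (s + r - 1) - r * (r - 1)"
    by (simp only: double_choose_two)
  moreover have "(s + r) * (s + r - 1) + s * (s + 1) = 2 * s * (s + r) + r * (r - 1)"
  proof (cases r)
    case 0
    then show ?thesis by (cases s) (auto simp: algebra_simps)
  qed (simp add: algebra_simps)
  moreover have "r * (r - 1) \<le> (s + r) * (s + r - 1)" by (intro mult_le_mono) auto
  ultimately show ?thesis unfolding r by linarith
qed

lemma extremal_insert:
  assumes e: "extremal s (V - {v})" and v: "v \<in> V" and N: "nbrs V v = V - {v}" and fin: "finite V"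
  shows "extremal (Suc s) V"
proof -
  obtain S where S: "S \<subseteq> V - {v}" "card S = s"
    "induced (V - {v}) = {e. e \<subseteq> V - {v} \<and> card e = 2 \<and> e \<inter> S \<noteq> {}}"
    using e by (auto simp: extremal_def)
  have "finite S" using S fin by (meson finite_Diff finite_subset)
  then have "card (insert v S) = Suc s" using S by (subst card_insert_disjoint) auto
  moreover have "insert v S \<subseteq> V" using S v by auto
  moreover have "induced V = {e. e \<subseteq> V \<and> card e = 2 \<and> e \<inter> insert v S \<noteq> {}}"
  proof (intro set_eqI)
    fix e
    show "e \<in> induced V \<longleftrightarrow> e \<in> {e. e \<subseteq> V \<and> card e = 2 \<and> e \<inter> insert v S \<noteq> {}}"
    proof (cases "v \<in> e")
      case True
      have "e \<in> E" if eV: "e \<subseteq> V" "card e = 2"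
      proof -
        obtain a b where "e = {a, b}" "a \<noteq> b" using eV(2) by (auto simp: card_2_iff)
        then obtain u where u: "e = {v, u}" "u \<noteq> v" using True by auto
        then have "u \<in> nbrs V v" using N eV by auto
        then show ?thesis using u by (simp add: nbrs_def adj_def)
      qed
      with True show ?thesis using card_edge by (auto simp: induced_def)
    next
      case False
      then have "e \<in> induced V \<longleftrightarrow> e \<in> induced (V - {v})" by (auto simp: induced_def)
      with False S(3) show ?thesis by auto
    qed
  qed
  ultimately show ?thesis unfolding extremal_def by blast
qed

text \<open>A vertex of degree at least \<open>2l(k\<^sub>1+k\<^sub>2)-1\<close> can be the centre of the last star whatever the rest
  of the forest is, so it is deleted and induction applies. If there is no such vertex, removing a
  maximal packing of \<open>k\<^sub>1\<close> paths and some stars destroys too few edges: by maximality at most one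
  vertex of each star has many neighbours outside the packing.\<close>

theorem extremal_forest:
  fixes V :: "'a set"
  assumes fin: "finite V" and k1: "2 \<le> k1" and l: "2 \<le> l"
    and n: "(2 * l * l + 3 * l) * k1 + (4 * l * l + 1) * k2 + 3 \<le> card V + 4 * k1 + 2 * l * k2"
    and free: "\<not> has_forest V l k1 k2" and s: "s + 1 = l * k1 + k2"
    and e: "2 * s * card V \<le> 2 * ecount V + s * (s + 1)"
  shows "extremal s V"
  using fin n free s e
proof (induction k2 arbitrary: V s)
  case 0
  have "5 * l * k1 + 3 \<le> card V" using bound_linear[OF l 0(2)] by simp
  then show ?case using extremal_path_forest[OF 0(1) k1 l] 0 by simp
next
  case (Suc d V s)
  note fin = Suc.prems(1) and n = Suc.prems(2) and free = Suc.prems(3) and e = Suc.prems(5)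
  have s: "s = l * k1 + d" using Suc.prems(4) by simp
  have l1: "1 \<le> l" using l by simp
  have lk: "4 \<le> l * k1" using mult_le_mono[OF l k1] by simp
  define D where "D = 2 * l * (k1 + d + 1) - 2"
  have "2 * 1 \<le> 2 * l * (k1 + d + 1)" using l by (intro mult_le_mono) auto
  then have D: "D + 2 = 2 * l * (k1 + d + 1)" by (simp add: D_def)
  define m where "m = card V"
  have arith: "s + 2 \<le> m" "2 * ((l - 1) * m) + 4 * l * k1 * D + 2 * l * d * (2 * l * d - 1)
      + 2 * (d * (D + (2 * l - 1) * (4 * l - 3))) + s * (s + 1) < 2 * s * m"
    using star_arith[OF l k1 _ s D, of m] n by (simp_all add: m_def)
  show ?case
  proof (cases "\<exists>v\<in>V. D + 1 \<le> card (nbrs V v)")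
    case True
    then obtain v where v: "v \<in> V" "D + 1 \<le> card (nbrs V v)" by blast
    obtain m' where m': "card V = Suc m'" "card (V - {v}) = m'"
      using v fin by (metis card.remove)
    have "0 < s" using s lk by linarith
    then obtain s' where s': "s = Suc s'" using gr0_implies_Suc by blast
    have free': "\<not> has_forest (V - {v}) l k1 d"
    proof
      assume "has_forest (V - {v}) l k1 d"
      then obtain ps ss where P: "length ps = k1" "length ss = d" "packing (V - {v}) l ps ss"
        unfolding has_forest_def by blast
      define Z where "Z = set (concat ps) \<union> set (concat ss)"
      have "card Z \<le> k1 * (2 * l) + d * (2 * l)"
        unfolding Z_def using packing_cards[OF P(3)] P(1,2) by (metis card_Un_le)
      then have "card Z + (2 * l - 1) \<le> D + 1" using D l by (simp add: algebra_simps)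
      moreover have "finite Z" by (simp add: Z_def)
      then have "card (nbrs V v) - card Z \<le> card (nbrs V v - Z)" by (rule diff_card_le_card_Diff)
      ultimately have "2 * l - 1 \<le> card (nbrs V v - Z)" using v(2) by linarith
      moreover have "v \<notin> Z" using packing_subset[OF P(3)] by (auto simp: Z_def)
      ultimately have "has_forest V l (length ps) (Suc (length ss))"
        using packing_add_star[OF P(3) _ fin v(1) l1 Z_def] by blast
      then show False using free P by simp
    qed
    have ec: "ecount V = ecount (V - {v}) + card (nbrs V v)" using ecount_remove[OF fin v(1)] .
    have sub: "nbrs V v \<subseteq> V - {v}" using nbrs_subset not_in_nbrs by blast
    have dm: "card (nbrs V v) \<le> m'" using card_mono[OF _ sub] fin m' by simp
    \<comment> \<open>Lowering both \<open>s\<close> and the number of vertices by one lowers the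
      extremal number by exactly \<open>m'\<close>, and \<open>v\<close> has degree at most
      \<open>m'\<close>. The exact count for \<open>V - {v}\<close> later forces \<open>v\<close> to
      be adjacent to everything.\<close>
    have e': "2 * s' * card (V - {v}) \<le> 2 * ecount (V - {v}) + s' * (s' + 1)"
      using e dm unfolding m' ec s' by (simp add: algebra_simps)
    have "extremal s' (V - {v})"
    proof (rule Suc.IH[OF _ _ free' _ e'])
      have "2 * l \<le> 4 * l * l" by simp
      moreover have "(4 * l * l + 1) * Suc d = (4 * l * l + 1) * d + 4 * l * l + 1" "2 * l * Suc d = 2 * l * d + 2 * l"
        by simp_all
      ultimately show "(2 * l * l + 3 * l) * k1 + (4 * l * l + 1) * d + 3 \<le> card (V - {v}) + 4 * k1 + 2 * l * d"
        using n unfolding m' by linarith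
    qed (use fin s s' in auto)
    then have "nbrs V v = V - {v}"
    proof -
      have "m' \<le> card (nbrs V v)"
        using ecount_extremal[OF \<open>extremal s' (V - {v})\<close>] fin e unfolding m' ec s' by (simp add: algebra_simps)
      then show ?thesis using sub fin dm m' by (intro card_subset_eq) auto
    qed
    with \<open>extremal s' (V - {v})\<close> show ?thesis using extremal_insert v(1) fin s' by blast
  next
    case False
    then have degs: "card (nbrs V v) \<le> D" if "v \<in> V" for v using that by force
    \<comment> \<open>Otherwise the result for paths alone, with \<open>s0 < s\<close>, would give
      fewer edges than assumed.\<close>
    have "has_forest V l k1 0"
    proof (rule ccontr)
      assume no: "\<not> has_forest V l k1 0"
      define s0 where "s0 = l * k1 - 1"
      have s0: "s0 + 1 = l * k1" "s = s0 + d + 1" using lk s by (simp_all add: s0_def)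
      have "s0 + d + 3 \<le> m" using arith(1) s0(2) by simp
      then obtain w where w: "m = s0 + d + 3 + w" using le_Suc_ex by blast
      have less: "2 * s0 * m + s * (s + 1) < 2 * s * m + s0 * (s0 + 1)"
        unfolding s0(2) w by (simp add: algebra_simps)
      have "5 * l * k1 + 3 \<le> card V" using bound_linear[OF l n] by simp
      moreover have "2 * s0 * card V \<le> 2 * ecount V + s0 * (s0 + 1)" using less e by (simp add: m_def)
      ultimately have "extremal s0 V" using extremal_path_forest[OF fin k1 l _ no s0(1)] by blast
      then show False using ecount_extremal[OF _ fin] less e by (fastforce simp: m_def)
    qed
    have "\<exists>j\<le>d. has_forest V l k1 j \<and> \<not> has_forest V l k1 (Suc j)"
    proof (rule ccontr)
      assume no: "\<not> ?thesis"
      have "has_forest V l k1 j" if "j \<le> Suc d" for j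
        using that by (induction j) (use \<open>has_forest V l k1 0\<close> no in auto)
      then show False using free by blast
    qed
    then obtain j where j: "j \<le> d" "has_forest V l k1 j" "\<not> has_forest V l k1 (Suc j)" by blast
    obtain ps ss where P: "length ps = k1" "length ss = j" "packing V l ps ss"
      using j(2) unfolding has_forest_def by blast
    define A where "A = set (concat ps)"
    define B where "B = set (concat ss)"
    define R where "R = V - (A \<union> B)"
    have sub: "A \<subseteq> V" "B \<subseteq> V" "R \<subseteq> V" using packing_subset[OF P(3)] by (auto simp: A_def B_def R_def)
    have fins: "finite A" "finite B" "finite R" using fin by (simp_all add: A_def B_def R_def)
    have cards: "card A = k1 * (2 * l)" "card B = j * (2 * l)"
      using packing_cards[OF P(3)] P(1,2) by (simp_all only: A_def B_def)
    have disj: "A \<inter> B = {}" using P(3) unfolding packing_def A_def B_def distinct_append by blast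
    have eR: "ecount R \<le> (l - 1) * m"
    proof -
      have "card (nbrs R v) \<le> 2 * (l - 1)" if v: "v \<in> R" for v
      proof (rule ccontr)
        assume "\<not> ?thesis"
        then have "2 * l - 1 \<le> card (nbrs R v)" by simp
        also have "nbrs R v = nbrs V v - (A \<union> B)" by (auto simp: nbrs_def R_def)
        finally have "has_forest V l (length ps) (Suc (length ss))"
          using packing_add_star[OF P(3) order_refl fin _ l1, of v "A \<union> B"] v by (simp add: A_def B_def R_def)
        then show False using j P by simp
      qed
      then have "(\<Sum>v\<in>R. card (nbrs R v)) \<le> card R * (2 * (l - 1))"
        using sum_bounded_above[of R "\<lambda>v. card (nbrs R v)" "2 * (l - 1)"] by simp
      then have "ecount R \<le> card R * (l - 1)" using handshake[OF fins(3)] by simp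
      also have "\<dots> \<le> m * (l - 1)"
        using card_mono[OF fin sub(3)] by (intro mult_right_mono) (simp_all add: m_def)
      finally show ?thesis by (simp add: mult.commute)
    qed
    \<comment> \<open>One vertex of a star is bounded only by the maximum degree \<open>D\<close>;
      the other \<open>2 * l - 1\<close> have at most \<open>4 * l - 3\<close> neighbours in
      \<open>R\<close>, or the star could be traded for two.\<close>
    define M where "M = D + (2 * l - 1) * (4 * l - 3)"
    have star: "(\<Sum>x\<in>set q. card (nbrs R x)) \<le> M" if q: "q \<in> set ss" for q
    proof -
      have ql: "length q = 2 * l" "set q \<subseteq> V" "q \<noteq> []" using P(3) q l unfolding packing_def by auto
      have "distinct q" using P(3) q by (auto simp: packing_def distinct_concat_iff)
      then have cq: "card (set q) = 2 * l" using ql by (simp add: distinct_card)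
      have pair: "x = y" if "x \<in> set q" "y \<in> set q" "4 * l - 2 \<le> card (nbrs R x)" "4 * l - 2 \<le> card (nbrs R y)" for x y
      proof (rule ccontr)
        assume "x \<noteq> y"
        then have "has_forest V l (length ps) (Suc (length ss))"
          using packing_split_star[OF P(3) fin l1 sub(3) _ q] that by (auto simp: R_def A_def B_def)
        then show False using j P by simp
      qed
      obtain x where x: "x \<in> set q" "\<And>y. y \<in> set q - {x} \<Longrightarrow> card (nbrs R y) \<le> 4 * l - 3"
      proof (cases "\<exists>x\<in>set q. 4 * l - 2 \<le> card (nbrs R x)")
        case True
        then obtain x where x: "x \<in> set q" "4 * l - 2 \<le> card (nbrs R x)" by blast
        show ?thesis
        proof (rule that[OF x(1)])
          fix y assume "y \<in> set q - {x}"
          then have "\<not> 4 * l - 2 \<le> card (nbrs R y)" using pair x by blast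
          then show "card (nbrs R y) \<le> 4 * l - 3" by linarith
        qed
      next
        case False
        show ?thesis
        proof (rule that)
          show "hd q \<in> set q" using ql by simp
          fix y assume "y \<in> set q - {hd q}"
          then have "\<not> 4 * l - 2 \<le> card (nbrs R y)" using False by blast
          then show "card (nbrs R y) \<le> 4 * l - 3" by linarith
        qed
      qed
      have "(\<Sum>y\<in>set q. card (nbrs R y)) = card (nbrs R x) + (\<Sum>y\<in>set q - {x}. card (nbrs R y))"
        using x(1) by (simp add: sum.remove)
      also have "(\<Sum>y\<in>set q - {x}. card (nbrs R y)) \<le> card (set q - {x}) * (4 * l - 3)"
        using sum_bounded_above[of "set q - {x}" "\<lambda>y. card (nbrs R y)" "4 * l - 3"] x(2) by simp
      also have "card (set q - {x}) = 2 * l - 1" using cq x(1) by simp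
      also have "card (nbrs R x) \<le> D"
        using card_nbrs_mono[OF sub(3) fin, of x] degs[of x] x(1) ql(2) by auto
      finally show ?thesis by (simp add: M_def)
    qed
    have eB: "2 * ecount B \<le> 2 * l * d * (2 * l * d - 1)"
    proof -
      have cB: "card B \<le> 2 * l * d" using cards j(1) by simp
      have "2 * ecount B \<le> card B * (card B - 1)" by (rule ecount_le_pairs[OF fins(2)])
      also have "\<dots> \<le> 2 * l * d * (2 * l * d - 1)" using cB by (intro mult_le_mono) auto
      finally show ?thesis .
    qed
    have "ecount (B \<union> R) \<le> ecount B + ecount R + (\<Sum>x\<in>B. card (nbrs R x))"
      using fins by (intro ecount_Un_le) (auto simp: R_def)
    also have "(\<Sum>x\<in>B. card (nbrs R x)) \<le> j * M"
      using sum_concat_le[of ss "\<lambda>x. card (nbrs R x)" M] star P(2) by (simp add: B_def)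
    also have "j * M \<le> d * M" using j(1) by simp
    finally have eBR: "ecount (B \<union> R) \<le> ecount B + ecount R + d * M" by simp
    have "ecount (A \<union> (B \<union> R)) \<le> ecount (B \<union> R) + (\<Sum>v\<in>A. card (nbrs V v))"
      using fins fin sub disj by (intro ecount_Un_le_degrees) (auto simp: R_def)
    also have "A \<union> (B \<union> R) = V" using sub by (auto simp: R_def)
    also have "(\<Sum>v\<in>A. card (nbrs V v)) \<le> card A * D"
      using sum_bounded_above[of A "\<lambda>v. card (nbrs V v)" D] degs sub(1) by auto
    also have "card A * D = 2 * l * k1 * D" by (simp add: cards)
    finally have "ecount V \<le> ecount (B \<union> R) + 2 * l * k1 * D" by simp
    then have "2 * ecount V + s * (s + 1) < 2 * s * m"
      using arith(2) eBR eR eB unfolding M_def by linarith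
    then show ?thesis using e by (simp add: m_def)
  qed
qed

end

section \<open>Translation to graphs\<close>

text \<open>The copy of \<open>F\<close> is its image under \<open>g\<close>; the isomorphism has to
  lead from the copy back to \<open>F\<close>, hence \<open>inv_into\<close>.\<close>

lemma not_graph_free_if_embedding:
  assumes F: "simple_graph F" and inj: "inj_on g (verts F)" and V: "g ` verts F \<subseteq> verts G"
    and E: "\<And>e. e \<in> edges F \<Longrightarrow> g ` e \<in> edges G"
  shows "\<not> graph_free F G"
proof -
  define H where "H = Graph (g ` verts F) ((`) g ` edges F)"
  define f where "f = inv_into (verts F) g"
  have sub: "e \<subseteq> verts F" "card e = 2" if "e \<in> edges F" for e
    using F that by (auto simp: simple_graph_def)
  have "simple_graph H"
    unfolding simple_graph_def
  proof (intro conjI ballI)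
    show "finite (verts H)" using F by (simp add: H_def simple_graph_def)
    fix e assume "e \<in> edges H"
    then obtain e' where e': "e' \<in> edges F" "e = g ` e'" by (auto simp: H_def)
    then show "e \<subseteq> verts H" using sub by (auto simp: H_def)
    have "inj_on g e'" using inj sub(1)[OF e'(1)] inj_on_subset by blast
    then show "card e = 2" using e' sub by (simp add: card_image)
  qed
  then have "subgraph H G" using V E by (auto simp: subgraph_def H_def)
  moreover have "isomorphic H F"
    unfolding isomorphic_def
  proof (intro exI[of _ f] conjI)
    show "bij_betw f (verts H) (verts F)"
      unfolding f_def H_def using inj by (simp add: bij_betw_inv_into bij_betw_imageI)
    have "f ` g ` e = e" if "e \<in> edges F" for e
      unfolding f_def using inj sub(1)[OF that] by (rule inv_into_image_cancel)
    then show "edges F = (`) f ` edges H" by (simp add: H_def image_image)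
  qed
  ultimately show ?thesis by (auto simp: graph_free_def)
qed

lemma verts_path_star_forest:
  "verts (path_star_forest k1 k2 l) = ({..<k1} \<times> {..<2 * l}) <+> ({..<k2} \<times> {..2 * l - 1})"
  by (simp add: path_star_forest_def disjoint_union_def copies_def path_graph_def star_graph_def)

lemma edges_path_star_forest:
  "e \<in> edges (path_star_forest k1 k2 l) \<longleftrightarrow>
     (\<exists>i x. i < k1 \<and> Suc x < 2 * l \<and> e = {Inl (i, x), Inl (i, Suc x)})
   \<or> (\<exists>i x. i < k2 \<and> 1 \<le> x \<and> x \<le> 2 * l - 1 \<and> e = {Inr (i, 0), Inr (i, x)})" (is "?L \<longleftrightarrow> ?R")
proof
  assume ?L
  then show ?R
    by (auto simp: path_star_forest_def disjoint_union_def copies_def path_graph_def star_graph_def) blast+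
next
  assume ?R
  then show ?L
  proof (elim disjE exE conjE)
    fix i x assume h: "i < k1" "Suc x < 2 * l" "e = {Inl (i, x), Inl (i, Suc x)}"
    then have "Pair i ` {x, Suc x} \<in> edges (copies k1 (path_graph (2 * l)))"
      unfolding copies_def path_graph_def graph.sel by blast
    moreover have "e = Inl ` Pair i ` {x, Suc x}" using h by simp
    ultimately show ?L unfolding path_star_forest_def disjoint_union_def graph.sel by blast
  next
    fix i x assume h: "i < k2" "1 \<le> x" "x \<le> 2 * l - 1" "e = {Inr (i, 0), Inr (i, x)}"
    then have "Pair i ` {0, x} \<in> edges (copies k2 (star_graph (2 * l - 1)))"
      unfolding copies_def star_graph_def graph.sel by blast
    moreover have "e = Inr ` Pair i ` {0, x}" using h by simp
    ultimately show ?L unfolding path_star_forest_def disjoint_union_def graph.sel by blast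
  qed
qed

lemma simple_path_star_forest:
  assumes "1 \<le> l"
  shows "simple_graph (path_star_forest k1 k2 l)"
  using assms by (auto simp: simple_graph_def verts_path_star_forest edges_path_star_forest)

lemma nth_nth_inject:
  assumes d: "distinct (concat xss)" and len: "\<forall>xs\<in>set xss. length xs = m"
    and i: "i < length xss" "a < m" and j: "j < length xss" "b < m" and eq: "xss ! i ! a = xss ! j ! b"
  shows "i = j \<and> a = b"
proof -
  \<comment> \<open>\<open>distinct_concat_iff\<close> disregards empty lists; there are none here,
    as \<open>a < m\<close> makes \<open>m\<close> positive.\<close>
  have "removeAll [] xss = xss"
    using len i(2) by (auto intro!: removeAll_id)
  then have D: "distinct xss" "\<forall>ys\<in>set xss. distinct ys"
    "\<forall>ys zs. ys \<in> set xss \<and> zs \<in> set xss \<and> ys \<noteq> zs \<longrightarrow> set ys \<inter> set zs = {}"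
    using d by (auto simp: distinct_concat_iff)
  have m: "xss ! i \<in> set xss" "xss ! j \<in> set xss" using i j by auto
  have "xss ! i ! a \<in> set (xss ! i) \<inter> set (xss ! j)"
    using m len i j eq by (metis IntI nth_mem)
  then have "xss ! i = xss ! j" using D(3) m by blast
  then have "i = j" using D(1) i j by (simp add: nth_eq_iff_index_eq)
  moreover have "a = b"
    using D(2) m eq \<open>i = j\<close> len i j by (metis nth_eq_iff_index_eq)
  ultimately show ?thesis by simp
qed

lemma edge_set_edges: "simple_graph G \<Longrightarrow> edge_set (edges G)"
  by unfold_locales (simp add: simple_graph_def)

lemma not_graph_free_if_has_forest:
  assumes G: "simple_graph G" and F: "edge_set.has_forest (edges G) (verts G) l k1 k2" and l: "1 \<le> l"
  shows "\<not> graph_free (path_star_forest k1 k2 l) G"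
proof -
  interpret edge_set "edges G" by (rule edge_set_edges[OF G])
  obtain ps ss where P: "length ps = k1" "length ss = k2" "packing (verts G) l ps ss"
    using F unfolding has_forest_def by blast
  have ps: "path_in (verts G) (ps ! i)" "length (ps ! i) = 2 * l" "ps ! i \<in> set ps" if "i < k1" for i
    using P that unfolding packing_def by (metis nth_mem)+
  have ss: "set (ss ! i) \<subseteq> verts G" "length (ss ! i) = 2 * l" "\<forall>u\<in>set (tl (ss ! i)). adj (hd (ss ! i)) u" "ss ! i \<in> set ss"
    if "i < k2" for i
    using P that unfolding packing_def by (metis nth_mem)+
  have d: "distinct (concat ps)" "distinct (concat ss)" "set (concat ps) \<inter> set (concat ss) = {}"
    "\<forall>p\<in>set ps. length p = 2 * l" "\<forall>q\<in>set ss. length q = 2 * l"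
    using P(3) unfolding packing_def distinct_append by blast+
  define g where "g x = (case x of Inl (i, a) \<Rightarrow> ps ! i ! a | Inr (i, a) \<Rightarrow> ss ! i ! a)" for x :: "nat \<times> nat + nat \<times> nat"
  have gps: "ps ! i ! a \<in> set (concat ps)" if "i < k1" "a < 2 * l" for i a
    using ps[OF that(1)] that(2) by (auto intro!: bexI[of _ "ps ! i"])
  have gss: "ss ! i ! a \<in> set (concat ss)" if "i < k2" "a < 2 * l" for i a
    using ss[OF that(1)] that(2) by (auto intro!: bexI[of _ "ss ! i"])
  have leaf: "a < 2 * l \<longleftrightarrow> a \<le> 2 * l - 1" for a using l by auto
  show ?thesis
  proof (rule not_graph_free_if_embedding[OF simple_path_star_forest[OF l]])
    show "inj_on g (verts (path_star_forest k1 k2 l))"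
    proof (rule inj_onI)
      fix x y assume xy: "x \<in> verts (path_star_forest k1 k2 l)" "y \<in> verts (path_star_forest k1 k2 l)" "g x = g y"
      obtain i a j b where "x = Inl (i, a) \<or> x = Inr (i, a)" "y = Inl (j, b) \<or> y = Inr (j, b)"
        by (metis sum.exhaust surj_pair)
      then show "x = y"
      proof (elim disjE)
        assume h: "x = Inl (i, a)" "y = Inl (j, b)"
        then show ?thesis
          using xy nth_nth_inject[OF d(1,4), of i a j b] P(1) by (auto simp: verts_path_star_forest g_def)
      next
        assume h: "x = Inr (i, a)" "y = Inr (j, b)"
        then show ?thesis
          using xy nth_nth_inject[OF d(2,5), of i a j b] P(2) by (auto simp: verts_path_star_forest g_def leaf)
      next
        assume h: "x = Inl (i, a)" "y = Inr (j, b)"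
        then have "ps ! i ! a = ss ! j ! b" "i < k1" "a < 2 * l" "j < k2" "b < 2 * l"
          using xy by (auto simp: verts_path_star_forest g_def leaf)
        then show ?thesis using gps[of i a] gss[of j b] d(3) by auto
      next
        assume h: "x = Inr (i, a)" "y = Inl (j, b)"
        then have "ps ! j ! b = ss ! i ! a" "i < k2" "a < 2 * l" "j < k1" "b < 2 * l"
          using xy by (auto simp: verts_path_star_forest g_def leaf)
        then show ?thesis using gps[of j b] gss[of i a] d(3) by auto
      qed
    qed
    have "g x \<in> verts G" if "x \<in> verts (path_star_forest k1 k2 l)" for x
    proof -
      have "g x \<in> set (concat ps) \<union> set (concat ss)"
        using that gps gss by (auto simp: verts_path_star_forest g_def leaf simp del: set_concat)
      then show ?thesis using packing_subset[OF P(3)] by blast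
    qed
    then show "g ` verts (path_star_forest k1 k2 l) \<subseteq> verts G" by blast
    fix e assume "e \<in> edges (path_star_forest k1 k2 l)"
    then show "g ` e \<in> edges G"
      unfolding edges_path_star_forest
    proof (elim disjE exE conjE)
      fix i x assume h: "i < k1" "Suc x < 2 * l" "e = {Inl (i, x), Inl (i, Suc x)}"
      have "successively adj (ps ! i)" using ps[OF h(1)] by (simp add: path_in_def)
      then have "adj (ps ! i ! x) (ps ! i ! Suc x)"
        using successively_nth ps(2)[OF h(1)] h(2) by metis
      then show ?thesis using h(3) by (simp add: g_def adj_def)
    next
      fix i x assume h: "i < k2" "1 \<le> x" "x \<le> 2 * l - 1" "e = {Inr (i, 0), Inr (i, x)}"
      obtain y ys where q: "ss ! i = y # ys" using ss(2)[OF h(1)] l by (cases "ss ! i") auto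
      obtain x' where x': "x = Suc x'" using h(2) by (cases x) auto
      have "ys ! x' \<in> set ys" using ss(2)[OF h(1)] q h(3) x' by auto
      then have "adj y (ys ! x')" using ss(3)[OF h(1)] q by simp
      then show ?thesis using h(4) q x' by (simp add: g_def adj_def)
    qed
  qed
qed

text \<open>The forest has a matching of size \<open>lk\<^sub>1+k\<^sub>2\<close>.\<close>

lemma graph_free_if_small_cover:
  assumes S: "finite S" "card S < l * k1 + k2" and l: "1 \<le> l"
    and cover: "\<And>e. e \<in> edges G \<Longrightarrow> e \<inter> S \<noteq> {}"
  shows "graph_free (path_star_forest k1 k2 l) G"
  unfolding graph_free_def
proof
  let ?F = "path_star_forest k1 k2 l"
  assume "\<exists>H. subgraph H G \<and> isomorphic H ?F"
  then obtain H where H: "simple_graph H" "edges H \<subseteq> edges G" and iso: "isomorphic H ?F"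
    unfolding subgraph_def by blast
  from iso obtain f where f: "edges ?F = (`) f ` edges H"
    unfolding isomorphic_def by blast
  define M :: "(nat \<times> nat + nat) \<Rightarrow> (nat \<times> nat + nat \<times> nat) set" where
    "M x = (case x of Inl (i, j) \<Rightarrow> {Inl (i, 2 * j), Inl (i, Suc (2 * j))} | Inr i \<Rightarrow> {Inr (i, 0), Inr (i, 1)})" for x
  define I where "I = ({..<k1} \<times> {..<l}) <+> {..<k2}"
  have M: "M x \<in> edges ?F" if x: "x \<in> I" for x
  proof (cases x)
    case (Inl p)
    obtain i a where "p = (i, a)" by (cases p)
    with Inl x show ?thesis
      unfolding edges_path_star_forest
      by (intro disjI1 exI[of _ i] exI[of _ "2 * a"]) (auto simp: I_def M_def)
  next
    case (Inr i)
    with x l show ?thesis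
      unfolding edges_path_star_forest
      by (intro disjI2 exI[of _ i] exI[of _ 1]) (auto simp: I_def M_def)
  qed
  \<comment> \<open>\<open>D\<close> recovers the index of a matching edge from either end, so the
    edges are disjoint and cover vertices chosen for different edges differ.\<close>
  define D where "D z = (case z of Inl (i, a) \<Rightarrow> Inl (i, a div 2) | Inr (i, a) \<Rightarrow> Inr i)" for z :: "nat \<times> nat + nat \<times> nat"
  have D: "D z = x" if "z \<in> M x" for x z
    using that by (auto simp: M_def D_def split: sum.splits prod.splits)
  have "\<exists>v\<in>verts H. v \<in> S \<and> f v \<in> M x" if x: "x \<in> I" for x
  proof -
    obtain e where e: "e \<in> edges H" "M x = f ` e" using M[OF x] f by blast
    then obtain v where "v \<in> e" "v \<in> S" using cover H(2) by blast
    moreover have "e \<subseteq> verts H" using H(1) e(1) by (simp add: simple_graph_def)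
    ultimately show ?thesis using e(2) by blast
  qed
  then obtain h where h: "\<And>x. x \<in> I \<Longrightarrow> h x \<in> verts H \<and> h x \<in> S \<and> f (h x) \<in> M x" by metis
  have "inj_on h I"
  proof (rule inj_onI)
    fix x y assume "x \<in> I" "y \<in> I" "h x = h y"
    then show "x = y" using h[of x] h[of y] D by metis
  qed
  moreover have "h ` I \<subseteq> S" using h by blast
  ultimately have "card I \<le> card S" using S(1) card_inj_on_le by blast
  moreover have "card I = l * k1 + k2" by (simp add: I_def card_Plus)
  ultimately show False using S(2) by simp
qed

text \<open>The extremal graph on any vertex set: one count and one isomorphism serve the
  \<open>nat\<close> graphs in \<open>ex\<close>, the sum type of \<open>G2\<close>, and arbitrary
  competitors.\<close>

definition split_graph :: "'a set \<Rightarrow> 'a set \<Rightarrow> 'a graph" where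
  "split_graph V S = Graph V {e. e \<subseteq> V \<and> card e = 2 \<and> e \<inter> S \<noteq> {}}"

lemma graph_free_split_graph:
  assumes "finite S" "card S < l * k1 + k2" "1 \<le> l"
  shows "graph_free (path_star_forest k1 k2 l) (split_graph V S)"
  using assms by (rule graph_free_if_small_cover) (auto simp: split_graph_def)

lemma simple_split_graph: "finite V \<Longrightarrow> simple_graph (split_graph V S)"
  by (simp add: simple_graph_def split_graph_def)

lemma induced_verts: "simple_graph G \<Longrightarrow> edge_set.induced (edges G) (verts G) = edges G"
  unfolding edge_set.induced_def[OF edge_set_edges] by (auto simp: simple_graph_def)

lemma ecount_verts: "simple_graph G \<Longrightarrow> edge_set.ecount (edges G) (verts G) = num_edges G"
  by (simp add: edge_set.ecount_def[OF edge_set_edges] induced_verts num_edges_def)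

lemma extremal_iff_split_graph:
  assumes "simple_graph G"
  shows "edge_set.extremal (edges G) s (verts G) \<longleftrightarrow> (\<exists>S\<subseteq>verts G. card S = s \<and> G = split_graph (verts G) S)"
  unfolding edge_set.extremal_def[OF edge_set_edges[OF assms]] induced_verts[OF assms] split_graph_def
  by (cases G) simp

lemma num_edges_split_graph:
  assumes "finite V" "S \<subseteq> V"
  shows "2 * num_edges (split_graph V S) + card S * (card S + 1) = 2 * card S * card V"
proof -
  let ?G = "split_graph V S"
  have G: "simple_graph ?G" "verts ?G = V" using assms simple_split_graph by (auto simp: split_graph_def)
  have "edge_set.extremal (edges ?G) (card S) (verts ?G)"
    unfolding extremal_iff_split_graph[OF G(1)] unfolding G(2) using assms(2) by blast
  from edge_set.ecount_extremal[OF edge_set_edges[OF G(1)] this] G assms show ?thesis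
    by (simp add: ecount_verts[OF G(1), unfolded G(2)])
qed

text \<open>Adjacency depends only on membership in \<open>S\<close>, so a bijection between
  \<open>S\<close> and \<open>T\<close> and one between their complements glue to an
  isomorphism.\<close>

lemma isomorphic_split_graph:
  assumes fin: "finite V" "finite W" and sub: "S \<subseteq> V" "T \<subseteq> W" and c: "card V = card W" "card S = card T"
  shows "isomorphic (split_graph V S) (split_graph W T)"
proof -
  have fins: "finite S" "finite T" using fin sub finite_subset by blast+
  obtain f where f: "bij_betw f S T" using fins c(2) finite_same_card_bij by blast
  have "card (V - S) = card (W - T)" using fins sub c by (simp add: card_Diff_subset)
  then obtain g where g: "bij_betw g (V - S) (W - T)" using fin finite_same_card_bij by blast
  define h where "h x = (if x \<in> S then f x else g x)" for x
  have hS: "bij_betw h S T" using f by (simp add: h_def cong: bij_betw_cong)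
  have hVS: "bij_betw h (V - S) (W - T)"
    using g by (subst bij_betw_cong[of _ _ g]) (auto simp: h_def)
  have "bij_betw h (S \<union> (V - S)) (T \<union> (W - T))"
    by (rule bij_betw_combine[OF hS hVS]) auto
  then have h: "bij_betw h V W" using sub by (simp add: Un_absorb1)
  have inj: "inj_on h V" and im: "h ` V = W" "h ` S = T"
    using h hS by (auto simp: bij_betw_def)
  have "{e. e \<subseteq> W \<and> card e = 2 \<and> e \<inter> T \<noteq> {}} = (`) h ` {e. e \<subseteq> V \<and> card e = 2 \<and> e \<inter> S \<noteq> {}}"
  proof (intro set_eqI iffI)
    fix e assume e: "e \<in> {e. e \<subseteq> W \<and> card e = 2 \<and> e \<inter> T \<noteq> {}}"
    define d where "d = {x \<in> V. h x \<in> e}"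
    have he: "h ` d = e" using e im(1) by (auto simp: d_def)
    moreover have "inj_on h d" using inj by (rule inj_on_subset) (auto simp: d_def)
    then have "card e = card d" using card_image he by metis
    moreover have "d \<inter> S \<noteq> {}"
    proof -
      obtain y where "y \<in> e" "y \<in> T" using e by blast
      then obtain x where "x \<in> S" "h x \<in> e" using im(2) by blast
      then show ?thesis using sub(1) by (auto simp: d_def)
    qed
    moreover have "d \<subseteq> V" by (auto simp: d_def)
    ultimately have "e = h ` d" "d \<in> {e. e \<subseteq> V \<and> card e = 2 \<and> e \<inter> S \<noteq> {}}" using e by auto
    then show "e \<in> (`) h ` {e. e \<subseteq> V \<and> card e = 2 \<and> e \<inter> S \<noteq> {}}" by (rule image_eqI)
  next
    fix e assume "e \<in> (`) h ` {e. e \<subseteq> V \<and> card e = 2 \<and> e \<inter> S \<noteq> {}}"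
    then obtain d where d: "d \<subseteq> V" "card d = 2" "d \<inter> S \<noteq> {}" "e = h ` d" by blast
    have "card e = 2" using card_image[OF inj_on_subset[OF inj d(1)]] d by simp
    moreover have "e \<subseteq> W" using d(1,4) im(1) by blast
    moreover have "e \<inter> T \<noteq> {}" using d(3,4) im(2) by blast
    ultimately show "e \<in> {e. e \<subseteq> W \<and> card e = 2 \<and> e \<inter> T \<noteq> {}}" by blast
  qed
  with h show ?thesis unfolding isomorphic_def split_graph_def by auto
qed

lemma G2_eq_split_graph:
  "G2 n k1 k2 l = split_graph ({..<l * k1 + k2 - 1} <+> {..<n - l * k1 - k2 + 1}) (Inl ` {..<l * k1 + k2 - 1})"
proof -
  let ?s = "l * k1 + k2 - 1" and ?r = "n - l * k1 - k2 + 1"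
  let ?V = "{..<?s} <+> {..<?r}"
  have "{e. e \<subseteq> ?V \<and> card e = 2 \<and> e \<inter> Inl ` {..<?s} \<noteq> {}}
      = (\<lambda>e. Inl ` e) ` {e. e \<subseteq> {..<?s} \<and> card e = 2} \<union> {{Inl u, Inr v} | u v. u < ?s \<and> v < ?r}" (is "?L = ?R")
  proof (intro set_eqI iffI)
    fix e assume e: "e \<in> ?L"
    then obtain u where u: "u < ?s" "Inl u \<in> e" by auto
    obtain x y where "e = {x, y}" "x \<noteq> y" using e by (auto simp: card_2_iff)
    then obtain z where z: "e = {Inl u, z}" "z \<noteq> Inl u" using u by auto
    show "e \<in> ?R"
    proof (cases z)
      case (Inl v)
      with z e have "e = Inl ` {u, v}" "v < ?s" "u \<noteq> v" by auto
      with u show ?thesis by (intro UnI1 image_eqI[of _ _ "{u, v}"]) auto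
    next
      case (Inr v)
      with z e u show ?thesis by auto
    qed
  next
    fix e assume "e \<in> ?R"
    then show "e \<in> ?L"
    proof
      assume "e \<in> (\<lambda>e. Inl ` e) ` {e. e \<subseteq> {..<?s} \<and> card e = 2}"
      then obtain d where d: "e = Inl ` d" "d \<subseteq> {..<?s}" "card d = 2" by blast
      then have "d \<noteq> {}" "card e = 2" by (auto simp: card_image)
      with d show ?thesis by blast
    qed auto
  qed
  then show ?thesis
    by (simp add: G2_def graph_join_def disjoint_union_def complete_graph_def edgeless_graph_def split_graph_def)
qed

text \<open>Asking only for at least the extremal number of edges lets one statement yield both the
  upper bound, over \<open>nat\<close>, and uniqueness, over \<open>'v\<close>.\<close>

theorem extremal_graph:
  fixes H :: "'v graph"
  assumes k1: "2 \<le> k1" and l: "2 \<le> l"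
    and n: "(2 * l * l + 3 * l) * k1 + (4 * l * l + 1) * k2 + 3 \<le> n + 4 * k1 + 2 * l * k2"
    and s: "s + 1 = l * k1 + k2"
    and H: "simple_graph H" "card (verts H) = n" "graph_free (path_star_forest k1 k2 l) H"
    and e: "2 * s * n \<le> 2 * num_edges H + s * (s + 1)"
  shows "\<exists>S\<subseteq>verts H. card S = s \<and> H = split_graph (verts H) S"
proof -
  have fin: "finite (verts H)" using H by (simp add: simple_graph_def)
  have "\<not> edge_set.has_forest (edges H) (verts H) l k1 k2"
    using not_graph_free_if_has_forest H l by (metis le_trans one_le_numeral)
  then have "edge_set.extremal (edges H) s (verts H)"
    using edge_set.extremal_forest[OF edge_set_edges[OF H(1)] fin k1 l _ _ s, of] n e
    by (simp add: H(2) ecount_verts[OF H(1)])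
  then show ?thesis using extremal_iff_split_graph[OF H(1)] by simp
qed

theorem theorem7:
  fixes k1 k2 l n :: nat
  assumes "k1 \<ge> 2" and "l \<ge> 2"
    and "int n \<ge> (2 * int l ^ 2 + 3 * int l - 4) * int k1
                  + (4 * int l ^ 2 - 2 * int l + 1) * int k2 + 3"
  shows "ex n (path_star_forest k1 k2 l) = num_edges (G2 n k1 k2 l)
    \<and> real (num_edges (G2 n k1 k2 l))
        = (real l * real k1 + real k2 - 1) * real n
          - (real l * real k1 + real k2) * (real l * real k1 + real k2 - 1) / 2
    \<and> simple_graph (G2 n k1 k2 l)
    \<and> card (verts (G2 n k1 k2 l)) = n
    \<and> graph_free (path_star_forest k1 k2 l) (G2 n k1 k2 l)
    \<and> (\<forall>H :: 'v graph.
          simple_graph H \<and> card (verts H) = n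
          \<and> graph_free (path_star_forest k1 k2 l) H
          \<and> num_edges H = num_edges (G2 n k1 k2 l)
          \<longrightarrow> isomorphic H (G2 n k1 k2 l))"
proof -
  note k1 = assms(1) and l = assms(2)
  let ?F = "path_star_forest k1 k2 l"
  define s where "s = l * k1 + k2 - 1"
  have "4 \<le> l * k1" using mult_le_mono[OF l k1] by simp
  then have s: "s + 1 = l * k1 + k2" by (simp add: s_def)
  \<comment> \<open>The negative terms of the bound move to the right, so natural numbers suffice
    from here on.\<close>
  have "int ((2 * l * l + 3 * l) * k1 + (4 * l * l + 1) * k2 + 3) \<le> int (n + 4 * k1 + 2 * l * k2)"
    using assms(3) by (simp add: algebra_simps power2_eq_square)
  then have n: "(2 * l * l + 3 * l) * k1 + (4 * l * l + 1) * k2 + 3 \<le> n + 4 * k1 + 2 * l * k2"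
    by (simp only: of_nat_le_iff)
  have "s + 1 \<le> 5 * l * k1 + k2" unfolding s by simp
  then have sn: "s + 1 \<le> n" using bound_linear[OF l n] by simp
  define V :: "(nat + nat) set" where "V = {..<s} <+> {..<n - s}"
  define S :: "(nat + nat) set" where "S = Inl ` {..<s}"
  have "n - l * k1 - k2 + 1 = n - s" using s sn by linarith
  then have G: "G2 n k1 k2 l = split_graph V S"
    by (simp only: G2_eq_split_graph V_def S_def s_def)
  have V: "finite V" "card V = n" "S \<subseteq> V" "card S = s"
    using sn by (auto simp: V_def S_def card_Plus card_image)
  have simple: "simple_graph (G2 n k1 k2 l)" and verts: "verts (G2 n k1 k2 l) = V"
    using V simple_split_graph by (auto simp: G split_graph_def)
  have cG: "2 * num_edges (G2 n k1 k2 l) + s * (s + 1) = 2 * s * n"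
    using num_edges_split_graph[OF V(1,3)] V(2,4) unfolding G by simp
  have le: "num_edges H \<le> num_edges (G2 n k1 k2 l)"
    if H: "simple_graph H" "card (verts H) = n" "graph_free ?F H" for H :: "nat graph"
  proof (rule ccontr)
    assume less: "\<not> ?thesis"
    \<comment> \<open>A free graph with more edges would still be a split graph, whose number of
      edges is known exactly.\<close>
    then obtain T where T: "T \<subseteq> verts H" "card T = s" "H = split_graph (verts H) T"
      using extremal_graph[OF k1 l n s H] cG by auto
    have "finite (verts H)" using H(1) by (simp add: simple_graph_def)
    then have "2 * num_edges H + s * (s + 1) = 2 * s * n"
      using num_edges_split_graph[of "verts H" T] T H(2) by metis
    then show False using less cG by simp
  qed
  have "ex n ?F = num_edges (G2 n k1 k2 l)"
    unfolding ex_def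
  proof (rule Max_eqI)
    let ?X = "{num_edges G |G :: nat graph. simple_graph G \<and> card (verts G) = n \<and> graph_free ?F G}"
    show "finite ?X" by (rule finite_subset[of _ "{..num_edges (G2 n k1 k2 l)}"]) (use le in auto)
    show "y \<le> num_edges (G2 n k1 k2 l)" if "y \<in> ?X" for y using that le by blast
    \<comment> \<open>\<open>G2\<close> lives on a sum type, whereas \<open>ex\<close> ranges over
      graphs on \<open>nat\<close>; the maximum is attained at a copy on
      \<open>{..<n}\<close>.\<close>
    have "simple_graph (split_graph {..<n} {..<s})" "card (verts (split_graph {..<n} {..<s})) = n"
      "graph_free ?F (split_graph {..<n} {..<s})"
      using simple_split_graph[of "{..<n}" "{..<s}"] graph_free_split_graph[of "{..<s}" l k1 k2] s l
      by (simp_all add: split_graph_def)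
    moreover have "num_edges (split_graph {..<n} {..<s}) = num_edges (G2 n k1 k2 l)"
      using num_edges_split_graph[of "{..<n}" "{..<s}"] cG sn by simp
    ultimately show "num_edges (G2 n k1 k2 l) \<in> ?X"
      by (metis (mono_tags, lifting) mem_Collect_eq)
  qed
  moreover have "real (num_edges (G2 n k1 k2 l))
        = (real l * real k1 + real k2 - 1) * real n
          - (real l * real k1 + real k2) * (real l * real k1 + real k2 - 1) / 2"
  proof -
    have "real (2 * num_edges (G2 n k1 k2 l) + s * (s + 1)) = real (2 * s * n)" using cG by (rule arg_cong)
    moreover have "real (s + 1) = real (l * k1 + k2)" using s by (rule arg_cong)
    then have "real l * real k1 + real k2 = real s + 1" by simp
    ultimately show ?thesis by (simp add: field_simps)
  qed
  moreover have "graph_free ?F (G2 n k1 k2 l)"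
    unfolding G using V(3,4) finite_subset[OF V(3,1)] s l by (intro graph_free_split_graph) auto
  moreover have "isomorphic H (G2 n k1 k2 l)"
    if H: "simple_graph H" "card (verts H) = n" "graph_free ?F H" "num_edges H = num_edges (G2 n k1 k2 l)"
    for H :: "'v graph"
  proof -
    obtain T where T: "T \<subseteq> verts H" "card T = s" "H = split_graph (verts H) T"
      using extremal_graph[OF k1 l n s H(1-3)] cG H(4) by auto
    have "finite (verts H)" using H(1) by (simp add: simple_graph_def)
    then have "isomorphic (split_graph (verts H) T) (split_graph V S)"
      using T(1,2) V H(2) by (intro isomorphic_split_graph) auto
    then show ?thesis unfolding G by (simp flip: T(3))
  qed
  ultimately show ?thesis using simple verts V(2) by blast
qed

end
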